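(* Consider the system, the time-varying Kalman gains $L_t^*$, and the objectives $\mathcal J_h$ (functions of $(A_{L_h},B_{L_h})\in\mathbb{R}^{n\times n}\times\mathbb{R}^{n\times m}$) described in the context. For every $h\in\{0,\dots,N-1\}$, the quadratic objective $\mathcal J_h$ is twice continuously differentiable, and its Hessian matrix can be represented as $$H_h=\mathbb{E}_{x_h,\hat x_h,v_h}\begin{bmatrix}\hat x_h\hat x_h^\top & \hat x_hy_h^\top\\ y_h\hat x_h^\top & y_hy_h^\top\end{bmatrix}=\begin{bmatrix}\mu_{\hat x_h}\mu_{\hat x_h}^\top+\Theta & (\mu_{\hat x_h}\mu_{x_h}^\top+\Theta)C^\top\\ C(\mu_{x_h}\mu_{\hat x_h}^\top+\Theta) & C(\mu_{x_h}\mu_{x_h}^\top+\Theta)C^\top+V\end{bmatrix}>0,$$ where $\mu_{\hat x_h}=\mathbb{E}[\hat x_h]$, $\mu_{x_h}=\mathbb{E}[x_h]$, and $\Theta>0$ is the covariance matrix of the zero-mean Gaussian random vector $\theta_0$. Moreover, $\mathcal J_h$ is strongly convex with constant $\lambda_{\min}(H_h)$ and smooth with constant $\lambda_{\max}(H_h)$. Lastly, introducing the additional random vector $\theta_0$ is without any loss of optimality, in the sense that the time-varying Kalman filter $(A_{L_h},B_{L_h})=(A-L_h^*C,\,L_h^* )$ is the unique minimizer of $\mathcal J_h$.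
   Context: Notation: for symmetric matrices, $X>0$ means positive definite; $\lambda_{\min},\lambda_{\max}$ are the smallest and largest eigenvalues. A function is smooth with constant $\ell$ if its gradient is $\ell$-Lipschitz. $N$ is a positive integer (the problem horizon). Setting: $x_{t+1}=Ax_t+w_t$, $y_t=Cx_t+v_t$ with $x_t\in\mathbb{R}^n$, $y_t\in\mathbb{R}^m$, i.i.d. zero-mean Gaussian noises $w_t\sim\mathcal N(0,W)$, $v_t\sim\mathcal N(0,V)$, $W,V>0$, and $x_0\sim\mathcal N(\bar x_0,X_0)$ with $\bar x_0\neq0$, $X_0>0$, with $x_0$, $\{w_t\}$, $\{v_t\}$ mutually independent. The pair $(C,A)$ is observable. Time-varying Kalman filter: $\Sigma_0^*=X_0$, $$L_t^*=A\Sigma_t^*C^\top(V+C\Sigma_t^*C^\top)^{-1},\qquad \Sigma^*_{t+1}=A\Sigma^*_tA^\top-A\Sigma^*_tC^\top(V+C\Sigma^*_tC^\top)^{-1}C\Sigma^*_tA^\top+W,$$ and $(A^*_{L_t},B^*_{L_t})=(A-L_t^*C,\,L_t^* )$. Static estimation objective: for $h\in\{0,\dots,N-1\}$, $$\mathcal J_h:=\mathbb{E}_{x_0,w_t,v_t,\theta_0}\Big\{\sum_{t=0}^{h+1}(x_t-\hat x_t)^\top(x_t-\hat x_t)\Big\},$$ where $\hat x_0=\bar x_0$, $x_0\sim\mathcal N(\bar x_0,X_0)$; for $t\in\{0,\dots,h-2\}$, $\hat x_{t+1}=A^*_{L_t}\hat x_t+B^*_{L_t}y_t$ and $x_{t+1}=Ax_t+w_t$;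 at time $h$, $$\hat x_h=A^*_{L_{h-1}}\hat x_{h-1}+B^*_{L_{h-1}}y_{h-1}+\theta_0,\qquad x_h=Ax_{h-1}+w_{h-1}+\theta_0;$$ and finally $x_{h+1}=Ax_h+w_h$, $\hat x_{h+1}=A_{L_h}\hat x_h+B_{L_h}y_h$, with $y_t=Cx_t+v_t$ throughout. For $h=0$ the noise $\theta_0$ is added to both the initial state and the initial estimate: $x_0=\xi+\theta_0$ with $\xi\sim\mathcal N(\bar x_0,X_0)$, and $\hat x_0=\bar x_0+\theta_0$. Here $\theta_0\sim\mathcal N(0,\Theta)$ takes values in $\mathbb{R}^n$, $\Theta>0$, and $\theta_0$ is independent of the initial state (of $\xi$ when $h=0$), $\{w_t\}$ and $\{v_t\}$. Convention on the Hessian: $\mathcal J_h$ is a quadratic function of the matrix $\pi_h=[A_{L_h}\mid B_{L_h}]\in\mathbb{R}^{n\times(n+m)}$, and the "Hessian matrix" $H_h\in\mathbb{R}^{(n+m)\times(n+m)}$ is written blockwise with respect to $(A_{L_h},B_{L_h})$, in the paper's form without constant factors.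
   Formalization: The printed block formula for H_h omits the covariance of x_h and its estimate due to x_0 and past noise (at h=0, CX_0C^T); the missing blocks are added. The Hessian form carries a factor 2, and smoothness with λ_max(H_h) is stated for J_h/2, since J_h itself needs 2λ_max(H_h). *)

theory Defs
  imports "HOL-Probability.Probability"
begin

subsection \<open>Matrices\<close>

definition posdef :: "real^'n^'n \<Rightarrow> bool" where
  "posdef S \<longleftrightarrow> transpose S = S \<and> (\<forall>x. x \<noteq> 0 \<longrightarrow> 0 < x \<bullet> (S *v x))"

definition eigenvalues :: "real^'n^'n \<Rightarrow> real set" where
  "eigenvalues S = {l. \<exists>x. x \<noteq> 0 \<and> S *v x = l *\<^sub>R x}"

definition lambda_min :: "real^'n^'n \<Rightarrow> real" where
  "lambda_min S = Min (eigenvalues S)"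

definition lambda_max :: "real^'n^'n \<Rightarrow> real" where
  "lambda_max S = Max (eigenvalues S)"

definition outer :: "real^'a \<Rightarrow> real^'b \<Rightarrow> real^'b^'a" where
  "outer u v = (\<chi> i j. u $ i * v $ j)"

definition block_mat ::
  "real^'a^'a \<Rightarrow> real^'b^'a \<Rightarrow> real^'a^'b \<Rightarrow> real^'b^'b \<Rightarrow> real^('a + 'b)^('a + 'b)" where
  "block_mat P Q R S = (\<chi> i j.
     (case i of
        Inl a \<Rightarrow> (case j of Inl a' \<Rightarrow> P $ a $ a' | Inr b' \<Rightarrow> Q $ a $ b')
      | Inr b \<Rightarrow> (case j of Inl a' \<Rightarrow> R $ b $ a' | Inr b' \<Rightarrow> S $ b $ b')))"

text \<open>The row of blocks \<open>[F | G]\<close>.\<close>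
definition hcat :: "(real^'a^'c) \<times> (real^'b^'c) \<Rightarrow> real^('a + 'b)^'c" where
  "hcat P = (\<chi> i j. case j of Inl a \<Rightarrow> fst P $ i $ a | Inr b \<Rightarrow> snd P $ i $ b)"

text \<open>The initial state is determined by the first \<open>n\<close> noise-free outputs.
  Iterates of \<open>(*v) A\<close> are used because \<open>A ^ k\<close> would be the entrywise power.\<close>
definition observable_pair :: "real^'n^'m \<Rightarrow> real^'n^'n \<Rightarrow> bool" where
  "observable_pair C A \<longleftrightarrow>
     (\<forall>x x'. (\<forall>k < CARD('n). C *v (((*v) A ^^ k) x) = C *v (((*v) A ^^ k) x')) \<longrightarrow> x = x')"

subsection \<open>Regularity of functions on Euclidean spaces\<close>

text \<open>On matrices and on pairs of matrices \<open>\<bullet>\<close> is the Frobenius inner product, so gradients and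
  Lipschitz constants below refer to the Frobenius norm.\<close>

definition gradient :: "('a::euclidean_space \<Rightarrow> real) \<Rightarrow> 'a \<Rightarrow> 'a" where
  "gradient f x = (SOME g. GDERIV f x :> g)"

definition twice_cont_differentiable :: "('a::euclidean_space \<Rightarrow> real) \<Rightarrow> bool" where
  "twice_cont_differentiable f \<longleftrightarrow>
     (\<forall>x. GDERIV f x :> gradient f x) \<and>
     (\<exists>D2 :: 'a \<Rightarrow> 'a \<Rightarrow>\<^sub>L 'a.
        (\<forall>x. (gradient f has_derivative blinfun_apply (D2 x)) (at x)) \<and> continuous_on UNIV D2)"

text \<open>The second derivative of \<open>f\<close> at \<open>x\<close> as a bilinear form.\<close>
definition hessian_form :: "('a::euclidean_space \<Rightarrow> real) \<Rightarrow> 'a \<Rightarrow> 'a \<Rightarrow> 'a \<Rightarrow> real" where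
  "hessian_form f x d d' = frechet_derivative (gradient f) (at x) d \<bullet> d'"

definition strongly_convex_with :: "real \<Rightarrow> ('a::euclidean_space \<Rightarrow> real) \<Rightarrow> bool" where
  "strongly_convex_with c f \<longleftrightarrow> 0 < c \<and> convex_on UNIV (\<lambda>x. f x - c / 2 * (norm x)\<^sup>2)"

definition smooth_with :: "real \<Rightarrow> ('a::euclidean_space \<Rightarrow> real) \<Rightarrow> bool" where
  "smooth_with l f \<longleftrightarrow> (\<forall>x. GDERIV f x :> gradient f x) \<and> l-lipschitz_on UNIV (gradient f)"

subsection \<open>Gaussian vectors and independence of the noise sources\<close>

text \<open>Non-degenerate normal law: every non-zero linear functional of \<open>X\<close> is normal with the
  mean and variance prescribed by \<open>\<mu>\<close> and \<open>S\<close>.\<close>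
definition gaussian_vec :: "'s measure \<Rightarrow> ('s \<Rightarrow> real^'n) \<Rightarrow> real^'n \<Rightarrow> real^'n^'n \<Rightarrow> bool" where
  "gaussian_vec M X \<mu> S \<longleftrightarrow> posdef S \<and> X \<in> borel_measurable M \<and>
     (\<forall>u. u \<noteq> 0 \<longrightarrow>
        distributed M lborel (\<lambda>\<omega>. u \<bullet> X \<omega>) (normal_density (u \<bullet> \<mu>) (sqrt (u \<bullet> (S *v u)))))"

datatype noise_source = Initial | Perturbation | Process nat | Measurement nat

text \<open>Mutual independence of \<open>\<xi>\<close>, \<open>\<theta>\<close>, all \<open>w t\<close> and all \<open>v t\<close>, stated through the generated
  sigma-algebras since \<open>indep_vars\<close> requires a common codomain type.\<close>
definition sources_independent ::
  "'s measure \<Rightarrow> ('s \<Rightarrow> real^'n) \<Rightarrow> ('s \<Rightarrow> real^'n) \<Rightarrow> (nat \<Rightarrow> 's \<Rightarrow> real^'n) \<Rightarrow>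
   (nat \<Rightarrow> 's \<Rightarrow> real^'m) \<Rightarrow> bool" where
  "sources_independent M \<xi> \<theta> w v \<longleftrightarrow>
     prob_space.indep_sets M
       (\<lambda>s. case s of
          Initial \<Rightarrow> sets (vimage_algebra (space M) \<xi> borel)
        | Perturbation \<Rightarrow> sets (vimage_algebra (space M) \<theta> borel)
        | Process t \<Rightarrow> sets (vimage_algebra (space M) (w t) borel)
        | Measurement t \<Rightarrow> sets (vimage_algebra (space M) (v t) borel))
       UNIV"

subsection \<open>Time-varying Kalman filter\<close>

definition kalman_gain :: "real^'n^'n \<Rightarrow> real^'n^'m \<Rightarrow> real^'m^'m \<Rightarrow> real^'n^'n \<Rightarrow> real^'m^'n" where
  "kalman_gain A C V S =
     A ** S ** transpose C ** matrix_inv (V + C ** S ** transpose C)"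

primrec kalman_cov ::
  "real^'n^'n \<Rightarrow> real^'n^'m \<Rightarrow> real^'n^'n \<Rightarrow> real^'m^'m \<Rightarrow> real^'n^'n \<Rightarrow> nat \<Rightarrow> real^'n^'n" where
  "kalman_cov A C W V X0 0 = X0"
| "kalman_cov A C W V X0 (Suc t) =
     (let S = kalman_cov A C W V X0 t in
        A ** S ** transpose A
        - A ** S ** transpose C ** matrix_inv (V + C ** S ** transpose C) ** C ** S ** transpose A
        + W)"

definition kalman_L ::
  "real^'n^'n \<Rightarrow> real^'n^'m \<Rightarrow> real^'n^'n \<Rightarrow> real^'m^'m \<Rightarrow> real^'n^'n \<Rightarrow> nat \<Rightarrow> real^'m^'n" where
  "kalman_L A C W V X0 t = kalman_gain A C V (kalman_cov A C W V X0 t)"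

definition kalman_policy ::
  "real^'n^'n \<Rightarrow> real^'n^'m \<Rightarrow> real^'n^'n \<Rightarrow> real^'m^'m \<Rightarrow> real^'n^'n \<Rightarrow> nat \<Rightarrow>
   (real^'n^'n) \<times> (real^'m^'n)" where
  "kalman_policy A C W V X0 t = (A - kalman_L A C W V X0 t ** C, kalman_L A C W V X0 t)"

text \<open>Covariance of the state \<open>x\<^sub>t\<close> of \<open>x\<^sub>t\<^sub>+\<^sub>1 = A x\<^sub>t + w\<^sub>t\<close> without the perturbation \<open>\<theta>\<close>.\<close>
primrec state_cov :: "real^'n^'n \<Rightarrow> real^'n^'n \<Rightarrow> real^'n^'n \<Rightarrow> nat \<Rightarrow> real^'n^'n" where
  "state_cov A W X0 0 = X0"
| "state_cov A W X0 (Suc t) = A ** state_cov A W X0 t ** transpose A + W"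

subsection \<open>Trajectories perturbed at time \<open>h\<close> and the static objective\<close>

primrec state ::
  "real^'n^'n \<Rightarrow> ('s \<Rightarrow> real^'n) \<Rightarrow> ('s \<Rightarrow> real^'n) \<Rightarrow> (nat \<Rightarrow> 's \<Rightarrow> real^'n) \<Rightarrow>
   nat \<Rightarrow> nat \<Rightarrow> 's \<Rightarrow> real^'n" where
  "state A \<xi> \<theta> w h 0 \<omega> = \<xi> \<omega> + (if h = 0 then \<theta> \<omega> else 0)"
| "state A \<xi> \<theta> w h (Suc t) \<omega> =
     A *v state A \<xi> \<theta> w h t \<omega> + w t \<omega> + (if h = Suc t then \<theta> \<omega> else 0)"

definition measurement ::
  "real^'n^'n \<Rightarrow> real^'n^'m \<Rightarrow> ('s \<Rightarrow> real^'n) \<Rightarrow> ('s \<Rightarrow> real^'n) \<Rightarrow> (nat \<Rightarrow> 's \<Rightarrow> real^'n) \<Rightarrow>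
   (nat \<Rightarrow> 's \<Rightarrow> real^'m) \<Rightarrow> nat \<Rightarrow> nat \<Rightarrow> 's \<Rightarrow> real^'m" where
  "measurement A C \<xi> \<theta> w v h t \<omega> = C *v state A \<xi> \<theta> w h t \<omega> + v t \<omega>"

text \<open>Estimates at times \<open>t \<le> h\<close>, which do not depend on the decision variable. The \<open>L t\<close> are
  the filter gains and \<open>m0\<close> is the mean of \<open>\<xi>\<close>.\<close>
primrec estimate ::
  "real^'n^'n \<Rightarrow> real^'n^'m \<Rightarrow> (nat \<Rightarrow> real^'m^'n) \<Rightarrow> real^'n \<Rightarrow> ('s \<Rightarrow> real^'n) \<Rightarrow>
   ('s \<Rightarrow> real^'n) \<Rightarrow> (nat \<Rightarrow> 's \<Rightarrow> real^'n) \<Rightarrow> (nat \<Rightarrow> 's \<Rightarrow> real^'m) \<Rightarrow> nat \<Rightarrow> nat \<Rightarrow> 's \<Rightarrow> real^'n"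
  where
  "estimate A C L m0 \<xi> \<theta> w v h 0 \<omega> = m0 + (if h = 0 then \<theta> \<omega> else 0)"
| "estimate A C L m0 \<xi> \<theta> w v h (Suc t) \<omega> =
     (A - L t ** C) *v estimate A C L m0 \<xi> \<theta> w v h t \<omega> + L t *v measurement A C \<xi> \<theta> w v h t \<omega>
     + (if h = Suc t then \<theta> \<omega> else 0)"

text \<open>The random cost under \<open>\<pi> = (F, G)\<close>: the last summand is the squared error at time \<open>h + 1\<close>,
  where the estimate is \<open>F\<close> times the estimate plus \<open>G\<close> times the output at time \<open>h\<close>.\<close>
definition cost ::
  "real^'n^'n \<Rightarrow> real^'n^'m \<Rightarrow> (nat \<Rightarrow> real^'m^'n) \<Rightarrow> real^'n \<Rightarrow> ('s \<Rightarrow> real^'n) \<Rightarrow>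
   ('s \<Rightarrow> real^'n) \<Rightarrow> (nat \<Rightarrow> 's \<Rightarrow> real^'n) \<Rightarrow> (nat \<Rightarrow> 's \<Rightarrow> real^'m) \<Rightarrow> nat \<Rightarrow>
   (real^'n^'n) \<times> (real^'m^'n) \<Rightarrow> 's \<Rightarrow> real" where
  "cost A C L m0 \<xi> \<theta> w v h \<pi> \<omega> =
     (let x = (\<lambda>t. state A \<xi> \<theta> w h t \<omega>);
          y = measurement A C \<xi> \<theta> w v h h \<omega>;
          xhat = (\<lambda>t. estimate A C L m0 \<xi> \<theta> w v h t \<omega>);
          xhat_next = fst \<pi> *v xhat h + snd \<pi> *v y
      in (\<Sum>t\<le>h. (x t - xhat t) \<bullet> (x t - xhat t))
         + (x (Suc h) - xhat_next) \<bullet> (x (Suc h) - xhat_next))"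

definition objective ::
  "'s measure \<Rightarrow> real^'n^'n \<Rightarrow> real^'n^'m \<Rightarrow> (nat \<Rightarrow> real^'m^'n) \<Rightarrow> real^'n \<Rightarrow> ('s \<Rightarrow> real^'n) \<Rightarrow>
   ('s \<Rightarrow> real^'n) \<Rightarrow> (nat \<Rightarrow> 's \<Rightarrow> real^'n) \<Rightarrow> (nat \<Rightarrow> 's \<Rightarrow> real^'m) \<Rightarrow> nat \<Rightarrow>
   (real^'n^'n) \<times> (real^'m^'n) \<Rightarrow> real" where
  "objective M A C L m0 \<xi> \<theta> w v h \<pi> = (\<integral>\<omega>. cost A C L m0 \<xi> \<theta> w v h \<pi> \<omega> \<partial>M)"

subsection \<open>The Hessian matrix\<close>

definition moment_integrand :: "real^'n \<Rightarrow> real^'m \<Rightarrow> real^('n + 'm)^('n + 'm)" where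
  "moment_integrand a b = block_mat (outer a a) (outer a b) (outer b a) (outer b b)"

text \<open>The expression in the means, \<open>\<Theta>\<close> and \<open>V\<close>. It is the second moment matrix of
  \<open>(xhat, C x + v)\<close> if \<open>\<theta>\<close> and \<open>v\<close> are the only sources of randomness.\<close>
definition mean_block ::
  "real^'n^'m \<Rightarrow> real^'m^'m \<Rightarrow> real^'n^'n \<Rightarrow> real^'n \<Rightarrow> real^'n \<Rightarrow> real^('n + 'm)^('n + 'm)" where
  "mean_block C V \<Theta> \<mu>xhat \<mu>x =
     block_mat (outer \<mu>xhat \<mu>xhat + \<Theta>)          ((outer \<mu>xhat \<mu>x + \<Theta>) ** transpose C)
               (C ** (outer \<mu>x \<mu>xhat + \<Theta>))     (C ** (outer \<mu>x \<mu>x + \<Theta>) ** transpose C + V)"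

text \<open>The contribution of the initial state and of the noise before time \<open>h\<close>, which
  \<open>mean_block\<close> leaves out: with \<open>\<theta>\<close> removed, the state at time \<open>h\<close> has covariance \<open>X\<close>, and the
  estimate has covariance \<open>P\<close>, which is also its cross-covariance with the state.\<close>
definition past_cov_block ::
  "real^'n^'m \<Rightarrow> real^'n^'n \<Rightarrow> real^'n^'n \<Rightarrow> real^('n + 'm)^('n + 'm)" where
  "past_cov_block C X P = block_mat P (P ** transpose C) (C ** P) (C ** X ** transpose C)"

end

theory Submission
  imports Defs
begin

text \<open>
  Write \<open>z = (xhat, y)\<close> for the stacked estimate and output at time \<open>h\<close>, and \<open>K = [F | G]\<close> for the
  decision variable. Up to a term that does not depend on \<open>K\<close>, the objective is the least squares
  cost \<open>E |x' - K z|\<^sup>2\<close> with the next state \<open>x'\<close> as target. Let \<open>K*\<close> be the Kalman policy. Since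
  \<open>\<theta>\<close> shifts the state and the estimate alike, the residual \<open>x' - K* z\<close> is the unperturbed estimation
  error at time \<open>h + 1\<close>. It is uncorrelated with \<open>z\<close>
  (\<open>prediction_error_orthogonal\<close>), so completing the square gives
  \<open>J(K) = J(K*) + ((K - K*) H) \<bullet> (K - K*)\<close> with \<open>H = E[z z\<^sup>T]\<close> (\<open>J_eq\<close>). Every analytic claim is
  a property of this quadratic function: the second derivative is \<open>\<Delta> \<mapsto> 2 \<Delta> H\<close>, the
  minimizer is \<open>K*\<close>, and the constants of strong convexity and smoothness of half of the
  function are the extreme Rayleigh quotients of \<open>H\<close>, which are its extreme eigenvalues.

  The stochastic part uses second moments only. The joint moment \<open>E[U Z\<^sup>T]\<close> is bilinear and
  vanishes for independent sources, at least one of which is centred. Induction over time then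
  yields the two invariants of the filter (\<open>error_moments\<close>): the error covariance follows the Riccati
  recursion, and the error is orthogonal to the estimate. They determine the blocks of \<open>H\<close>
  (\<open>H_eq\<close>). For positivity, \<open>z\<close> is split into the uncorrelated parts \<open>(xh, C x)\<close> and
  \<open>(\<theta>, C \<theta> + v)\<close>; the first has a positive semidefinite moment matrix, the second a positive
  definite one, because \<open>\<Theta>\<close> and \<open>V\<close> are positive definite (\<open>posdef_H\<close>).
\<close>

section \<open>Symmetric matrices and their extreme eigenvalues\<close>

lemma inner_symmetric_matrix:
  fixes S :: "real^'n^'n"
  assumes "transpose S = S"
  shows "x \<bullet> (S *v y) = (S *v x) \<bullet> y"
  by (metis assms dot_lmul_matrix transpose_matrix_vector)

lemma inner_matrix_vector_mult:
  fixes A :: "real^'a^'b"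
  shows "x \<bullet> (A *v y) = (transpose A *v x) \<bullet> y"
  by (simp add: dot_lmul_matrix)

lemma Cauchy_Schwarz_self_adjoint:
  fixes T :: "'a::real_inner \<Rightarrow> 'a"
  assumes lin: "linear T" and sa: "\<And>x y. x \<bullet> T y = T x \<bullet> y" and psd: "\<And>x. 0 \<le> x \<bullet> T x"
  shows "(x \<bullet> T y)\<^sup>2 \<le> (x \<bullet> T x) * (y \<bullet> T y)"
proof -
  have q: "0 \<le> (x \<bullet> T x) * t\<^sup>2 + 2 * (x \<bullet> T y) * t + y \<bullet> T y" for t
  proof -
    have "0 \<le> (t *\<^sub>R x + y) \<bullet> T (t *\<^sub>R x + y)" by (rule psd)
    also have "\<dots> = (x \<bullet> T x) * t\<^sup>2 + 2 * (x \<bullet> T y) * t + y \<bullet> T y"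
      by (simp add: linear_add[OF lin] linear_scale[OF lin] inner_add_left inner_add_right
          sa[of y x] inner_commute[of "T y" x] power2_eq_square algebra_simps)
    finally show ?thesis .
  qed
  show ?thesis
  proof (cases "x \<bullet> T x = 0")
    case True
    have "x \<bullet> T y = 0"
    proof (rule ccontr)
      assume "x \<bullet> T y \<noteq> 0"
      \<comment> \<open>The polynomial is affine with non-zero slope, and takes the value \<open>-1\<close> here.\<close>
      then show False
        using q[of "- (y \<bullet> T y + 1) / (2 * (x \<bullet> T y))"] True by simp
    qed
    then show ?thesis using True by simp
  next
    case False
    then have pos: "0 < x \<bullet> T x" using psd[of x] by simp
    \<comment> \<open>The polynomial is evaluated at its minimizer.\<close>
    have "0 \<le> (x \<bullet> T x) * ((x \<bullet> T x) * (- (x \<bullet> T y) / (x \<bullet> T x))\<^sup>2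
        + 2 * (x \<bullet> T y) * (- (x \<bullet> T y) / (x \<bullet> T x)) + y \<bullet> T y)"
      using q[of "- (x \<bullet> T y) / (x \<bullet> T x)"] pos by (intro mult_nonneg_nonneg) linarith+
    also have "\<dots> = (x \<bullet> T x) * (y \<bullet> T y) - (x \<bullet> T y)\<^sup>2"
      using pos by (simp add: field_simps power2_eq_square)
    finally show ?thesis by simp
  qed
qed

lemma finite_eigenvalues:
  fixes S :: "real^'n^'n"
  assumes sym: "transpose S = S"
  shows "finite (eigenvalues S)"
proof -
  have "\<forall>l\<in>eigenvalues S. \<exists>x. x \<noteq> 0 \<and> S *v x = l *\<^sub>R x"
    by (auto simp: eigenvalues_def)
  then obtain e where e: "\<And>l. l \<in> eigenvalues S \<Longrightarrow> e l \<noteq> 0 \<and> S *v e l = l *\<^sub>R e l"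
    by metis
  have orth: "e k \<bullet> e l = 0" if "k \<in> eigenvalues S" "l \<in> eigenvalues S" "k \<noteq> l" for k l
  proof -
    have "l * (e k \<bullet> e l) = k * (e k \<bullet> e l)"
      using inner_symmetric_matrix[OF sym, of "e k" "e l"] e that by simp
    then show ?thesis using that by simp
  qed
  have "inj_on e (eigenvalues S)"
    using orth e by (metis (no_types, lifting) inj_onI inner_eq_zero_iff)
  moreover have "independent (e ` eigenvalues S)"
    using e by (intro pairwise_orthogonal_independent)
      (auto simp: pairwise_def orthogonal_def intro!: orth)
  then have "finite (e ` eigenvalues S)"
    using independent_bound by blast
  ultimately show ?thesis
    by (simp add: finite_image_iff)
qed

text \<open>The maximum of the Rayleigh quotient is attained on the unit sphere. At a maximiser \<open>u\<close>
  with value \<open>l\<close>, the positive semidefinite form of \<open>l - S\<close> vanishes, and by the Cauchy--Schwarz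
  inequality \<open>u\<close> lies in the kernel of \<open>l - S\<close>.\<close>
lemma rayleigh_maximum_is_eigenvalue:
  fixes S :: "real^'n^'n"
  assumes sym: "transpose S = S"
  obtains l where "l \<in> eigenvalues S" "\<And>x. x \<bullet> (S *v x) \<le> l * (norm x)\<^sup>2"
proof -
  have ne: "sphere (0::real^'n) 1 \<noteq> {}" by simp
  have "continuous_on (sphere 0 1) (\<lambda>x. x \<bullet> (S *v x))"
    by (intro continuous_intros)
  from continuous_attains_sup[OF compact_sphere ne this]
  obtain u where u: "norm u = 1" and max: "\<And>x. norm x = 1 \<Longrightarrow> x \<bullet> (S *v x) \<le> u \<bullet> (S *v u)"
    by auto
  define l where "l = u \<bullet> (S *v u)"
  have le: "x \<bullet> (S *v x) \<le> l * (norm x)\<^sup>2" for x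
  proof (cases "x = 0")
    case False
    have "(x /\<^sub>R norm x) \<bullet> (S *v (x /\<^sub>R norm x)) \<le> l"
      unfolding l_def using False by (intro max) simp
    then show ?thesis
      using False by (simp add: matrix_vector_mult_scaleR field_simps power2_eq_square)
  qed simp
  define T where "T x = l *\<^sub>R x - S *v x" for x
  have Tlin: "linear T"
    unfolding T_def by (intro linear_compose_sub) (auto intro!: linearI simp: algebra_simps)
  have Tsa: "x \<bullet> T y = T x \<bullet> y" for x y
    unfolding T_def
    by (simp add: inner_diff_left inner_diff_right inner_symmetric_matrix[OF sym])
  have Tpsd: "0 \<le> x \<bullet> T x" for x
    using le[of x] by (simp add: T_def inner_diff_right power2_norm_eq_inner)
  have "u \<bullet> T u = 0"
    using u by (simp add: T_def inner_diff_right l_def norm_eq_1)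
  then have "(T u \<bullet> T u)\<^sup>2 \<le> 0"
    using Cauchy_Schwarz_self_adjoint[OF Tlin Tsa Tpsd, of "T u" u] by simp
  then have "S *v u = l *\<^sub>R u" by (simp add: T_def)
  moreover have "u \<noteq> 0" using u by auto
  ultimately have "l \<in> eigenvalues S" by (auto simp: eigenvalues_def)
  then show ?thesis using le that by blast
qed

lemma minus_matrix_vector_mult: "(- A) *v x = - (A *v x)" for A :: "real^'a^'b"
  by (simp add: vec_eq_iff matrix_vector_mult_def sum_negf)

lemma eigenvalues_uminus: "l \<in> eigenvalues (- S) \<Longrightarrow> - l \<in> eigenvalues S"
  unfolding eigenvalues_def mem_Collect_eq minus_matrix_vector_mult scaleR_minus_left
  by (metis minus_minus)

lemma rayleigh_le_lambda_max:
  fixes S :: "real^'n^'n"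
  assumes "transpose S = S"
  shows "x \<bullet> (S *v x) \<le> lambda_max S * (norm x)\<^sup>2"
proof -
  obtain l where l: "l \<in> eigenvalues S" "\<And>x. x \<bullet> (S *v x) \<le> l * (norm x)\<^sup>2"
    using rayleigh_maximum_is_eigenvalue[OF assms] by blast
  have "l \<le> lambda_max S"
    unfolding lambda_max_def using l finite_eigenvalues[OF assms] by simp
  then show ?thesis
    using l(2)[of x] by (meson mult_right_mono order_trans zero_le_power2)
qed

lemma lambda_min_le_rayleigh:
  fixes S :: "real^'n^'n"
  assumes "transpose S = S"
  shows "lambda_min S * (norm x)\<^sup>2 \<le> x \<bullet> (S *v x)"
proof -
  have "transpose (- S) = - S" using assms by (auto simp: transpose_def vec_eq_iff)
  then obtain l where l: "l \<in> eigenvalues (- S)"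
      "\<And>x. x \<bullet> ((- S) *v x) \<le> l * (norm x)\<^sup>2"
    using rayleigh_maximum_is_eigenvalue by blast
  have "lambda_min S \<le> - l"
    unfolding lambda_min_def using eigenvalues_uminus[OF l(1)] finite_eigenvalues[OF assms]
    by simp
  then have "lambda_min S * (norm x)\<^sup>2 \<le> - l * (norm x)\<^sup>2"
    by (meson mult_right_mono zero_le_power2)
  also have "\<dots> \<le> x \<bullet> (S *v x)"
    using l(2)[of x] by (simp add: minus_matrix_vector_mult)
  finally show ?thesis .
qed

lemma posdef_lambda_min_pos:
  fixes S :: "real^'n^'n"
  assumes "posdef S"
  shows "0 < lambda_min S"
proof -
  have sym: "transpose S = S" using assms by (simp add: posdef_def)
  have "eigenvalues S \<noteq> {}"
    using rayleigh_maximum_is_eigenvalue[OF sym] by blast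
  then have "lambda_min S \<in> eigenvalues S"
    unfolding lambda_min_def using finite_eigenvalues[OF sym] by simp
  then obtain x where x: "x \<noteq> 0" "S *v x = lambda_min S *\<^sub>R x"
    by (auto simp: eigenvalues_def)
  have "0 < x \<bullet> (S *v x)"
    using assms x(1) by (simp add: posdef_def)
  then have "0 < lambda_min S * (x \<bullet> x)"
    unfolding x(2) by (simp only: inner_scaleR_right)
  then show ?thesis
    using inner_ge_zero[of x] by (simp only: zero_less_mult_iff) auto
qed

lemma posdef_quadratic_form_nonneg: "posdef S \<Longrightarrow> 0 \<le> x \<bullet> (S *v x)"
  by (cases "x = 0") (auto simp: posdef_def intro: less_imp_le)

lemma posdef_lambda_max_nonneg:
  fixes S :: "real^'n^'n"
  assumes "posdef S"
  shows "0 \<le> lambda_max S"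
proof -
  obtain y :: "real^'n" where "norm y = 1" using vector_choose_size[of 1] by auto
  then show ?thesis
    using rayleigh_le_lambda_max[of S y] posdef_quadratic_form_nonneg[OF assms, of y] assms
    by (simp add: posdef_def)
qed

text \<open>The Cauchy--Schwarz inequality for the form of \<open>S\<close>, at \<open>S x\<close> and \<open>x\<close>, bounds \<open>|S x|\<^sup>4\<close> by two
  values of the form, each of which is at most \<open>lambda_max S\<close> times a squared norm.\<close>
lemma posdef_norm_le_lambda_max:
  fixes S :: "real^'n^'n"
  assumes "posdef S"
  shows "norm (S *v x) \<le> lambda_max S * norm x"
proof (cases "S *v x = 0")
  case True
  then show ?thesis using posdef_lambda_max_nonneg[OF assms] by simp
next
  case False
  have sym: "transpose S = S" using assms by (simp add: posdef_def)
  note nn = posdef_quadratic_form_nonneg[OF assms]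
  define y where "y = S *v x"
  have "(y \<bullet> (S *v x))\<^sup>2 \<le> (y \<bullet> (S *v y)) * (x \<bullet> (S *v x))"
    by (rule Cauchy_Schwarz_self_adjoint[OF matrix_vector_mul_linear inner_symmetric_matrix[OF sym] nn])
  also have "\<dots> \<le> (lambda_max S * (norm y)\<^sup>2) * (lambda_max S * (norm x)\<^sup>2)"
    by (rule mult_mono'[OF rayleigh_le_lambda_max[OF sym] rayleigh_le_lambda_max[OF sym] nn nn])
  finally have "(norm y)\<^sup>2 * (norm y)\<^sup>2 \<le> (norm y)\<^sup>2 * (lambda_max S * norm x)\<^sup>2"
    unfolding y_def[symmetric] by (simp add: dot_square_norm power_mult_distrib power2_eq_square mult_ac)
  then have le: "(norm y)\<^sup>2 \<le> (lambda_max S * norm x)\<^sup>2"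
    by (rule mult_left_le_imp_le) (simp add: y_def False)
  have "norm y \<le> lambda_max S * norm x"
    using posdef_lambda_max_nonneg[OF assms] by (intro power2_le_imp_le[OF le]) simp
  then show ?thesis by (simp add: y_def)
qed

lemma posdef_matrix_inv_left:
  fixes S :: "real^'n^'n"
  assumes "posdef S"
  shows "matrix_inv S ** S = mat 1"
proof -
  have "S *v x = 0 \<Longrightarrow> x = 0" for x
    using assms by (metis posdef_def inner_zero_right less_irrefl)
  then have "invertible S"
    unfolding invertible_left_inverse matrix_left_invertible_ker by blast
  then obtain B where "S ** B = mat 1 \<and> B ** S = mat 1"
    by (auto simp: invertible_def)
  then show ?thesis
    unfolding matrix_inv_def
    by (rule someI[where P = "\<lambda>B. S ** B = mat 1 \<and> B ** S = mat 1", THEN conjunct2])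
qed

section \<open>Quadratic functions on Euclidean spaces\<close>

lemma gradient_eqI:
  assumes "GDERIV f x :> g"
  shows "gradient f x = g"
proof -
  have "GDERIV f x :> gradient f x"
    unfolding gradient_def using assms by (rule someI)
  then have "(\<lambda>d. d \<bullet> gradient f x) = (\<lambda>d. d \<bullet> g)"
    using assms unfolding gderiv_def by (rule has_derivative_unique)
  then have "d \<bullet> gradient f x = d \<bullet> g" for d by (rule fun_cong)
  then show ?thesis using vector_eq_ldot by blast
qed

text \<open>A quadratic function written around its critical point \<open>a\<close>. The Hessian is \<open>2 T\<close>.\<close>
locale quadratic_function =
  fixes f :: "'a::euclidean_space \<Rightarrow> real" and T :: "'a \<Rightarrow> 'a" and a :: 'a and c :: real
  assumes linear: "linear T" and self_adjoint: "\<And>x y. x \<bullet> T y = T x \<bullet> y"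
    and f_eq: "\<And>x. f x = c + T (x - a) \<bullet> (x - a)"
begin

lemma scaled: "quadratic_function (\<lambda>x. r * f x) (\<lambda>d. r *\<^sub>R T d) a (r * c)"
  by unfold_locales
    (simp_all add: linear_add[OF linear] linear_scale[OF linear] self_adjoint f_eq algebra_simps)

lemma T_has_derivative: "((\<lambda>x. T (x - a)) has_derivative T) (at x)"
proof -
  have "((\<lambda>x. T x - T a) has_derivative (\<lambda>d. T d - 0)) (at x)"
    using linear_imp_has_derivative[OF linear] by (intro has_derivative_diff has_derivative_const)
  then show ?thesis by (simp add: linear_diff[OF linear])
qed

lemma gderiv: "GDERIV f x :> 2 *\<^sub>R T (x - a)"
proof -
  have "(f has_derivative (\<lambda>d. T (x - a) \<bullet> d + T d \<bullet> (x - a))) (at x)"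
    unfolding f_eq by (auto intro!: derivative_eq_intros T_has_derivative)
  also have "(\<lambda>d. T (x - a) \<bullet> d + T d \<bullet> (x - a)) = (\<lambda>d. d \<bullet> (2 *\<^sub>R T (x - a)))"
  proof
    fix d
    show "T (x - a) \<bullet> d + T d \<bullet> (x - a) = d \<bullet> (2 *\<^sub>R T (x - a))"
      by (simp add: self_adjoint[of d] inner_commute[of "T (x - a)"])
  qed
  finally show ?thesis by (simp add: gderiv_def)
qed

lemma gradient: "gradient f = (\<lambda>x. 2 *\<^sub>R T (x - a))"
  using gradient_eqI[OF gderiv] by blast

lemma gradient_has_derivative: "(gradient f has_derivative (\<lambda>d. 2 *\<^sub>R T d)) (at x)"
  unfolding gradient by (auto intro!: derivative_eq_intros T_has_derivative)

lemma twice_cont_differentiable: "twice_cont_differentiable f"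
proof -
  have "bounded_linear (\<lambda>d. 2 *\<^sub>R T d)"
    using gradient_has_derivative by (rule has_derivative_bounded_linear)
  then have "(gradient f has_derivative blinfun_apply (Blinfun (\<lambda>d. 2 *\<^sub>R T d))) (at x)" for x
    using gradient_has_derivative by (simp add: bounded_linear_Blinfun_apply)
  then show ?thesis
    unfolding twice_cont_differentiable_def using gderiv gradient
    by (metis continuous_on_const)
qed

lemma hessian_form: "hessian_form f x d d' = 2 * (T d \<bullet> d')"
  unfolding hessian_form_def
  by (simp flip: frechet_derivative_at[OF gradient_has_derivative[of x]])

lemma smooth_with:
  assumes "\<And>d. 2 * norm (T d) \<le> l * norm d" "0 \<le> l"
  shows "smooth_with l f"
  unfolding smooth_with_def gradient
proof (intro conjI allI lipschitz_onI)
  show "dist (2 *\<^sub>R T (x - a)) (2 *\<^sub>R T (y - a)) \<le> l * dist x y" for x y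
    using assms(1)[of "x - y"]
    by (simp add: dist_norm linear_diff[OF linear] flip: scaleR_diff_right)
qed (simp_all add: gderiv assms)

lemma strongly_convex_with:
  assumes "0 < k" and coercive: "\<And>d. k / 2 * (norm d)\<^sup>2 \<le> T d \<bullet> d"
  shows "strongly_convex_with k f"
  unfolding strongly_convex_with_def
proof (intro conjI convex_onI)
  fix t :: real and x y :: 'a
  assume t: "0 < t" "t < 1"
  \<comment> \<open>A quadratic form differs from its chord by a multiple of its value at \<open>x - y\<close>.\<close>
  have chord: "R ((1 - t) *\<^sub>R p + t *\<^sub>R q) \<bullet> ((1 - t) *\<^sub>R p + t *\<^sub>R q)
      = (1 - t) * (R p \<bullet> p) + t * (R q \<bullet> q) - t * (1 - t) * (R (p - q) \<bullet> (p - q))"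
    if "Real_Vector_Spaces.linear R" "\<And>x y. x \<bullet> R y = R x \<bullet> y" for R :: "'a \<Rightarrow> 'a" and p q
  proof -
    have "R q \<bullet> p = R p \<bullet> q" by (metis that(2) inner_commute)
    then show ?thesis
      by (simp add: linear_add[OF that(1)] linear_diff[OF that(1)] linear_scale[OF that(1)]
          inner_add_left inner_add_right inner_diff_left inner_diff_right algebra_simps)
  qed
  have shift: "(1 - t) *\<^sub>R x + t *\<^sub>R y - a = (1 - t) *\<^sub>R (x - a) + t *\<^sub>R (y - a)"
    by (simp add: algebra_simps)
  have f: "f ((1 - t) *\<^sub>R x + t *\<^sub>R y)
      = (1 - t) * f x + t * f y - t * (1 - t) * (T (x - y) \<bullet> (x - y))"
    unfolding f_eq shift chord[OF linear self_adjoint] by (simp add: algebra_simps)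
  have n: "(norm ((1 - t) *\<^sub>R x + t *\<^sub>R y))\<^sup>2
      = (1 - t) * (norm x)\<^sup>2 + t * (norm y)\<^sup>2 - t * (1 - t) * (norm (x - y))\<^sup>2"
    unfolding power2_norm_eq_inner using chord[of id x y] by (simp add: linear_id)
  define r where "r = k / 2"
  have "0 \<le> t * (1 - t) * (T (x - y) \<bullet> (x - y) - r * (norm (x - y))\<^sup>2)"
    using t coercive by (simp add: r_def)
  then show "f ((1 - t) *\<^sub>R x + t *\<^sub>R y) - k / 2 * (norm ((1 - t) *\<^sub>R x + t *\<^sub>R y))\<^sup>2
      \<le> (1 - t) * (f x - k / 2 * (norm x)\<^sup>2) + t * (f y - k / 2 * (norm y)\<^sup>2)"
    unfolding f n r_def[symmetric] by (simp add: algebra_simps)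
qed (use assms in auto)

lemma is_arg_min_iff:
  assumes "\<And>d. d \<noteq> 0 \<Longrightarrow> 0 < T d \<bullet> d"
  shows "is_arg_min f (\<lambda>_. True) x \<longleftrightarrow> x = a"
proof -
  have "f a < f y" if "y \<noteq> a" for y
    using assms[of "y - a"] that by (simp add: f_eq linear_0[OF linear])
  then show ?thesis
    by (metis is_arg_min_def less_asym)
qed

end

section \<open>Matrix algebra, stacked vectors and block matrices\<close>

lemma matrix_add_rdistrib: "(A + B) ** C = A ** C + B ** C" for A B :: "'a::semiring_1^'n^'m"
  by (simp add: matrix_matrix_mult_def vec_eq_iff sum.distrib distrib_right)

lemma matrix_diff_ldistrib: "A ** (B - C) = A ** B - A ** C" for A :: "real^'n^'m"
  by (simp add: matrix_matrix_mult_def vec_eq_iff sum_subtractf right_diff_distrib)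

lemma matrix_diff_rdistrib: "(A - B) ** C = A ** C - B ** C" for A B :: "real^'n^'m"
  by (simp add: matrix_matrix_mult_def vec_eq_iff sum_subtractf left_diff_distrib)

lemma matrix_scaleR_right: "A ** (r *\<^sub>R B) = r *\<^sub>R (A ** B)" for A :: "real^'n^'m"
  by (simp add: matrix_matrix_mult_def vec_eq_iff sum_distrib_left mult_ac)

lemma scaleR_matrix_mult: "(r *\<^sub>R A) ** B = r *\<^sub>R (A ** B)" for A :: "real^'n^'m"
  by (simp add: matrix_matrix_mult_def vec_eq_iff sum_distrib_left mult_ac)

lemma transpose_add: "transpose (A + B) = transpose A + transpose B"
  by (simp add: transpose_def vec_eq_iff)

lemma transpose_diff: "transpose (A - B) = transpose A - transpose B"
  by (simp add: transpose_def vec_eq_iff)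

lemma transpose_zero: "transpose 0 = 0"
  by (simp add: transpose_def vec_eq_iff)

lemma transpose_outer: "transpose (outer a b) = outer b a"
  by (simp add: transpose_def outer_def vec_eq_iff mult.commute)

lemma matrix_vector_mult_outer: "outer (A *v a) b = A ** outer a b"
  by (simp add: outer_def matrix_vector_mult_def matrix_matrix_mult_def vec_eq_iff
      sum_distrib_right mult.assoc)

lemma inner_outer: "outer a b \<bullet> D = a \<bullet> (D *v b)"
  by (simp add: outer_def inner_vec_def matrix_vector_mult_def sum_distrib_left mult_ac)

lemma outer_vector_mult: "outer a b *v x = (b \<bullet> x) *\<^sub>R a"
  by (simp add: outer_def inner_vec_def matrix_vector_mult_def sum_distrib_left sum_distrib_right
      vec_eq_iff mult_ac)

lemma norm_outer: "norm (outer a b) = norm a * norm b"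
proof -
  have "(norm (outer a b))\<^sup>2 = (norm a * norm b)\<^sup>2"
    unfolding power_mult_distrib power2_norm_eq_inner inner_outer outer_vector_mult
    by simp
  then show ?thesis by simp
qed

lemma bounded_bilinear_outer: "bounded_bilinear outer"
proof
  show "\<exists>K. \<forall>a b. norm (outer a b) \<le> norm a * norm b * K"
    by (rule exI[of _ 1]) (simp add: norm_outer)
qed (simp_all add: outer_def vec_eq_iff algebra_simps)

lemmas outer_simps =
  bounded_bilinear.add_left[OF bounded_bilinear_outer]
  bounded_bilinear.add_right[OF bounded_bilinear_outer]
  bounded_bilinear.diff_left[OF bounded_bilinear_outer]
  bounded_bilinear.diff_right[OF bounded_bilinear_outer]

text \<open>A symmetric matrix is determined by its quadratic form (polarization).\<close>
lemma symmetric_matrix_eqI: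
  fixes S T :: "real^'n^'n"
  assumes sym: "transpose S = S" "transpose T = T"
    and eq: "\<And>u. u \<bullet> (S *v u) = u \<bullet> (T *v u)"
  shows "S = T"
proof -
  define D where "D = S - T"
  have symD: "transpose D = D" using sym by (simp add: D_def transpose_diff)
  have z: "u \<bullet> (D *v u) = 0" for u
    using eq[of u] by (simp add: D_def matrix_vector_mult_diff_rdistrib inner_diff_right)
  have "y \<bullet> (D *v x) = 0" for x y
  proof -
    have "(x + y) \<bullet> (D *v (x + y)) = x \<bullet> (D *v x) + y \<bullet> (D *v y) + 2 * (y \<bullet> (D *v x))"
      using inner_symmetric_matrix[OF symD, of x y]
      by (simp add: matrix_vector_right_distrib inner_add_left inner_add_right inner_commute)
    then show ?thesis by (simp only: z)
  qed
  then have "D *v x = 0" for x using inner_eq_zero_iff by blast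
  then have "D = 0" by (simp add: matrix_eq)
  then show ?thesis by (simp add: D_def)
qed

text \<open>The stacked column vector with upper part \<open>a\<close> and lower part \<open>b\<close>.\<close>
definition vjoin :: "real^'a \<Rightarrow> real^'b \<Rightarrow> real^('a + 'b)" where
  "vjoin a b = (\<chi> i. case i of Inl k \<Rightarrow> a $ k | Inr k \<Rightarrow> b $ k)"

text \<open>The upper and the lower part of a stacked vector.\<close>
definition vtop :: "real^('a::finite + 'b::finite) \<Rightarrow> real^'a" where "vtop z = (\<chi> i. z $ Inl i)"
definition vbot :: "real^('a::finite + 'b::finite) \<Rightarrow> real^'b" where "vbot z = (\<chi> i. z $ Inr i)"

lemma vjoin_vtop_vbot: "vjoin (vtop z) (vbot z) = z"
  by (auto simp: vjoin_def vtop_def vbot_def vec_eq_iff split: sum.split)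

lemma sum_UNIV_sum_type:
  "(\<Sum>i\<in>(UNIV :: ('a::finite + 'b::finite) set). f i) = (\<Sum>i\<in>UNIV. f (Inl i)) + (\<Sum>i\<in>UNIV. f (Inr i))"
  by (simp add: sum.Plus flip: UNIV_Plus_UNIV)

lemma inner_vjoin: "vjoin a b \<bullet> vjoin c d = a \<bullet> c + b \<bullet> d"
  by (simp add: inner_vec_def sum_UNIV_sum_type vjoin_def)

lemma norm_vjoin: "(norm (vjoin a b))\<^sup>2 = (norm a)\<^sup>2 + (norm b)\<^sup>2"
  by (simp add: power2_norm_eq_inner inner_vjoin)

lemma vjoin_zero: "vjoin 0 0 = 0"
  by (auto simp: vjoin_def vec_eq_iff split: sum.split)

lemma moment_integrand_vjoin: "moment_integrand a b = outer (vjoin a b) (vjoin a b)"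
  by (auto simp: moment_integrand_def block_mat_def outer_def vjoin_def vec_eq_iff split: sum.split)

lemma block_mat_vector_mult:
  "block_mat P Q R S *v vjoin a b = vjoin (P *v a + Q *v b) (R *v a + S *v b)"
  by (auto simp: block_mat_def vjoin_def matrix_vector_mult_def vec_eq_iff sum_UNIV_sum_type
      split: sum.split)

lemma block_mat_add:
  "block_mat P Q R S + block_mat P' Q' R' S' = block_mat (P + P') (Q + Q') (R + R') (S + S')"
  by (auto simp: block_mat_def vec_eq_iff split: sum.split)

lemma transpose_block_mat:
  "transpose (block_mat P Q R S) = block_mat (transpose P) (transpose R) (transpose Q) (transpose S)"
  by (auto simp: block_mat_def transpose_def vec_eq_iff split: sum.split)

lemma hcat_vjoin: "hcat \<pi> *v vjoin a b = fst \<pi> *v a + snd \<pi> *v b"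
  by (simp add: hcat_def vjoin_def matrix_vector_mult_def vec_eq_iff sum_UNIV_sum_type)

lemma inner_hcat: "hcat \<pi> \<bullet> hcat \<pi>' = \<pi> \<bullet> \<pi>'"
  by (simp add: inner_vec_def sum_UNIV_sum_type hcat_def inner_prod_def sum.distrib)

lemma hcat_diff: "hcat (\<pi> - \<pi>') = hcat \<pi> - hcat \<pi>'"
  by (auto simp: hcat_def vec_eq_iff split: sum.split)

lemma hcat_add: "hcat (\<pi> + \<pi>') = hcat \<pi> + hcat \<pi>'"
  by (auto simp: hcat_def vec_eq_iff split: sum.split)

lemma hcat_zero: "hcat 0 = 0"
  by (auto simp: hcat_def vec_eq_iff split: sum.split)

lemma hcat_scaleR: "hcat (r *\<^sub>R \<pi>) = r *\<^sub>R hcat \<pi>"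
  by (auto simp: hcat_def vec_eq_iff split: sum.split)

lemma norm_hcat: "norm (hcat \<pi>) = norm \<pi>"
  by (simp add: norm_eq_sqrt_inner inner_hcat)

text \<open>The inverse of \<open>hcat\<close>: the two blocks of a matrix \<open>[F | G]\<close>.\<close>
definition hsplit :: "real^('a::finite + 'b::finite)^'c \<Rightarrow> (real^'a^'c) \<times> (real^'b^'c)" where
  "hsplit K = ((\<chi> i j. K $ i $ Inl j), (\<chi> i j. K $ i $ Inr j))"

lemma hcat_hsplit: "hcat (hsplit K) = K"
  by (auto simp: hcat_def hsplit_def vec_eq_iff split: sum.split)

lemma linear_hsplit: "linear hsplit"
  by (auto intro!: linearI simp: hsplit_def vec_eq_iff)

lemma inner_hsplit: "hsplit K \<bullet> \<pi> = K \<bullet> hcat \<pi>"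
  by (metis hcat_hsplit inner_hcat)

lemma norm_hsplit: "norm (hsplit K) = norm K"
  by (metis hcat_hsplit norm_hcat)

text \<open>For symmetric \<open>H\<close>, right multiplication by \<open>H\<close> acts on each row as \<open>H\<close>. Hence the form
  \<open>(K H) \<bullet> K\<close> and the Frobenius norm of \<open>K H\<close> inherit the eigenvalue bounds of \<open>H\<close>.\<close>
lemma matrix_mult_symmetric_nth:
  fixes K :: "real^'k^'n"
  assumes "transpose H = H"
  shows "(K ** H) $ i = H *v (K $ i)"
proof -
  have "H $ k $ j = H $ j $ k" for j k
    using assms by (metis transpose_def vec_lambda_beta)
  then show ?thesis
    by (simp add: matrix_matrix_mult_def matrix_vector_mult_def vec_eq_iff mult.commute)
qed

lemma inner_rows: "K \<bullet> K' = (\<Sum>i\<in>UNIV. (K $ i) \<bullet> (K' $ i))" for K K' :: "real^'k^'n"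
  by (rule inner_vec_def)

lemma inner_matrix_mult_symmetric_commute:
  fixes K K' :: "real^'k^'n"
  assumes "transpose H = H"
  shows "K \<bullet> (K' ** H) = (K ** H) \<bullet> K'"
  by (simp add: inner_rows matrix_mult_symmetric_nth[OF assms] inner_symmetric_matrix[OF assms])

lemma inner_matrix_mult_ge_lambda_min:
  fixes K :: "real^'k^'n"
  assumes "posdef H"
  shows "lambda_min H * (norm K)\<^sup>2 \<le> (K ** H) \<bullet> K"
proof -
  have sym: "transpose H = H" using assms by (simp add: posdef_def)
  have "lambda_min H * (norm K)\<^sup>2 = (\<Sum>i\<in>UNIV. lambda_min H * (norm (K $ i))\<^sup>2)"
    by (simp add: power2_norm_eq_inner inner_rows sum_distrib_left)
  also have "\<dots> \<le> (\<Sum>i\<in>UNIV. (K $ i) \<bullet> (H *v (K $ i)))"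
    by (intro sum_mono lambda_min_le_rayleigh[OF sym])
  also have "\<dots> = (K ** H) \<bullet> K"
    by (simp add: inner_rows matrix_mult_symmetric_nth[OF sym] inner_commute)
  finally show ?thesis .
qed

lemma norm_matrix_mult_le_lambda_max:
  fixes K :: "real^'k^'n"
  assumes "posdef H"
  shows "norm (K ** H) \<le> lambda_max H * norm K"
proof (rule power2_le_imp_le)
  have sym: "transpose H = H" using assms by (simp add: posdef_def)
  have "(norm (K ** H))\<^sup>2 = (\<Sum>i\<in>UNIV. (norm (H *v (K $ i)))\<^sup>2)"
    by (simp add: power2_norm_eq_inner inner_rows matrix_mult_symmetric_nth[OF sym])
  also have "\<dots> \<le> (\<Sum>i\<in>UNIV. (lambda_max H * norm (K $ i))\<^sup>2)"
    by (intro sum_mono power_mono posdef_norm_le_lambda_max[OF assms]) simp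
  also have "\<dots> = (lambda_max H * norm K)\<^sup>2"
    by (simp add: power_mult_distrib power2_norm_eq_inner inner_rows sum_distrib_left)
  finally show "(norm (K ** H))\<^sup>2 \<le> (lambda_max H * norm K)\<^sup>2" .
qed (simp add: posdef_lambda_max_nonneg[OF assms])

text \<open>At the stacked vector \<open>(a, b)\<close> the quadratic form of \<open>mean_block\<close> is
  \<open>(a \<bullet> \<mu>xhat + c \<bullet> \<mu>x)\<^sup>2 + (a + c) \<bullet> \<Theta> (a + c) + b \<bullet> V b\<close> with \<open>c = C\<^sup>T b\<close>.\<close>
lemma posdef_mean_block:
  fixes C :: "real^'n^'m"
  assumes V: "posdef V" and \<Theta>: "posdef \<Theta>"
  shows "posdef (mean_block C V \<Theta> \<mu>xhat \<mu>x)"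
  unfolding posdef_def
proof (intro conjI allI impI)
  have sym: "transpose V = V" "transpose \<Theta> = \<Theta>"
    using assms by (auto simp: posdef_def)
  show "transpose (mean_block C V \<Theta> \<mu>xhat \<mu>x) = mean_block C V \<Theta> \<mu>xhat \<mu>x"
    by (simp add: mean_block_def transpose_block_mat transpose_add transpose_outer
        matrix_transpose_mul sym matrix_mul_assoc)
  fix z :: "real^('n + 'm)" assume z: "z \<noteq> 0"
  define a b where "a = vtop z" and "b = vbot z"
  define c where "c = transpose C *v b"
  have z_eq: "z = vjoin a b" by (simp add: a_def b_def vjoin_vtop_vbot)
  have bC: "b \<bullet> (C *v x) = c \<bullet> x" for x
    unfolding c_def by (rule inner_matrix_vector_mult)
  have form: "z \<bullet> (mean_block C V \<Theta> \<mu>xhat \<mu>x *v z)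
      = (a \<bullet> \<mu>xhat + c \<bullet> \<mu>x)\<^sup>2 + (a + c) \<bullet> (\<Theta> *v (a + c)) + b \<bullet> (V *v b)"
    unfolding z_eq mean_block_def block_mat_vector_mult inner_vjoin
    by (simp add: matrix_vector_mult_add_rdistrib matrix_vector_right_distrib
        inner_add_left inner_add_right bC outer_vector_mult c_def[symmetric] power2_eq_square
        inner_commute[of \<mu>x] inner_commute[of \<mu>xhat] algebra_simps
        flip: matrix_vector_mul_assoc del: transpose_matrix_vector)
  have nn: "0 \<le> (a + c) \<bullet> (\<Theta> *v (a + c))"
    by (rule posdef_quadratic_form_nonneg[OF \<Theta>])
  show "0 < z \<bullet> (mean_block C V \<Theta> \<mu>xhat \<mu>x *v z)"
  proof (cases "b = 0")
    case True
    then have "c = 0" by (simp add: c_def del: transpose_matrix_vector)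
    moreover have "a \<noteq> 0" using z True vjoin_zero by (auto simp: z_eq)
    ultimately have "0 < (a + c) \<bullet> (\<Theta> *v (a + c))" using \<Theta> by (simp add: posdef_def)
    then show ?thesis unfolding form using True
      by (simp add: add_nonneg_pos)
  next
    case False
    then have "0 < b \<bullet> (V *v b)" using V by (simp add: posdef_def)
    then show ?thesis unfolding form using nn by (simp add: add_nonneg_pos)
  qed
qed

section \<open>Second moments of random vectors\<close>

text \<open>Measurable with a finite second moment of the Euclidean norm.\<close>
definition square_integrable :: "'s measure \<Rightarrow> ('s \<Rightarrow> real^'n) \<Rightarrow> bool" where
  "square_integrable M U \<longleftrightarrow> U \<in> borel_measurable M \<and> integrable M (\<lambda>\<omega>. (norm (U \<omega>))\<^sup>2)"

text \<open>The matrix \<open>E[U Z\<^sup>T]\<close> of uncentred second moments. For square integrable vectors it is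
  bilinear, so that second moments of linear recursions can be computed by matrix algebra.\<close>
definition cross_moment :: "'s measure \<Rightarrow> ('s \<Rightarrow> real^'a) \<Rightarrow> ('s \<Rightarrow> real^'b) \<Rightarrow> real^'b^'a" where
  "cross_moment M U Z = (\<integral>\<omega>. outer (U \<omega>) (Z \<omega>) \<partial>M)"

lemma integral_linear:
  fixes T :: "'a::euclidean_space \<Rightarrow> 'b::euclidean_space"
  shows "linear T \<Longrightarrow> integrable M f \<Longrightarrow> (\<integral>\<omega>. T (f \<omega>) \<partial>M) = T (\<integral>\<omega>. f \<omega> \<partial>M)"
  by (simp add: integral_bounded_linear linear_conv_bounded_linear)

lemma square_integrable_measurable: "square_integrable M U \<Longrightarrow> U \<in> borel_measurable M"
  by (simp add: square_integrable_def)

lemma square_integrable_boundI: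
  assumes "U \<in> borel_measurable M" "integrable M g" "\<And>\<omega>. (norm (U \<omega>))\<^sup>2 \<le> g \<omega>"
  shows "square_integrable M U"
  unfolding square_integrable_def
proof
  show "integrable M (\<lambda>\<omega>. (norm (U \<omega>))\<^sup>2)"
  proof (rule Bochner_Integration.integrable_bound[OF assms(2)])
    show "(\<lambda>\<omega>. (norm (U \<omega>))\<^sup>2) \<in> borel_measurable M"
      using assms(1) by measurable
    have "norm ((norm (U \<omega>))\<^sup>2) \<le> norm (g \<omega>)" for \<omega>
      using assms(3)[of \<omega>] by simp
    then show "AE \<omega> in M. norm ((norm (U \<omega>))\<^sup>2) \<le> norm (g \<omega>)" by simp
  qed
qed fact

lemma square_integrable_matrix_mult:
  fixes A :: "real^'a^'b"
  assumes U: "square_integrable M U"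
  shows "square_integrable M (\<lambda>\<omega>. A *v U \<omega>)"
proof -
  obtain K where K: "\<And>x. norm (A *v x) \<le> norm x * K"
    using bounded_linear.bounded[OF matrix_vector_mul_bounded_linear[of A]] by blast
  have [measurable]: "U \<in> borel_measurable M" using U by (rule square_integrable_measurable)
  show ?thesis
  proof (rule square_integrable_boundI)
    show "(\<lambda>\<omega>. A *v U \<omega>) \<in> borel_measurable M"
      by (rule measurable_compose[OF _ borel_measurable_continuous_onI])
        (rule square_integrable_measurable[OF U], rule matrix_vector_mult_linear_continuous_on)
    show "integrable M (\<lambda>\<omega>. (norm (U \<omega>))\<^sup>2 * K\<^sup>2)"
      using U by (simp add: square_integrable_def)
    show "(norm (A *v U \<omega>))\<^sup>2 \<le> (norm (U \<omega>))\<^sup>2 * K\<^sup>2" for \<omega>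
      using power_mono[OF K, of "U \<omega>" 2] by (simp add: power_mult_distrib)
  qed
qed

lemma square_integrable_add:
  assumes "square_integrable M U" "square_integrable M Z"
  shows "square_integrable M (\<lambda>\<omega>. U \<omega> + Z \<omega>)"
proof (rule square_integrable_boundI)
  show "(\<lambda>\<omega>. U \<omega> + Z \<omega>) \<in> borel_measurable M"
    using assms[THEN square_integrable_measurable] by measurable
  show "integrable M (\<lambda>\<omega>. 2 * (norm (U \<omega>))\<^sup>2 + 2 * (norm (Z \<omega>))\<^sup>2)"
    using assms by (simp add: square_integrable_def)
  fix \<omega>
  have "(norm (U \<omega> + Z \<omega>))\<^sup>2 \<le> (norm (U \<omega>) + norm (Z \<omega>))\<^sup>2"
    by (intro power_mono norm_triangle_ineq) simp
  also have "\<dots> \<le> 2 * (norm (U \<omega>))\<^sup>2 + 2 * (norm (Z \<omega>))\<^sup>2"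
    using zero_le_power2[of "norm (U \<omega>) - norm (Z \<omega>)"] by (simp add: power2_sum power2_diff)
  finally show "(norm (U \<omega> + Z \<omega>))\<^sup>2 \<le> 2 * (norm (U \<omega>))\<^sup>2 + 2 * (norm (Z \<omega>))\<^sup>2" .
qed

lemma square_integrable_uminus:
  "square_integrable M U \<Longrightarrow> square_integrable M (\<lambda>\<omega>. - U \<omega>)"
  by (simp add: square_integrable_def)

lemma square_integrable_diff:
  assumes "square_integrable M U" "square_integrable M Z"
  shows "square_integrable M (\<lambda>\<omega>. U \<omega> - Z \<omega>)"
  using square_integrable_add[OF assms(1) square_integrable_uminus[OF assms(2)]] by simp

lemma square_integrable_vjoin:
  assumes "square_integrable M U" "square_integrable M Z"
  shows "square_integrable M (\<lambda>\<omega>. vjoin (U \<omega>) (Z \<omega>))"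
proof (rule square_integrable_boundI)
  have "continuous_on UNIV (\<lambda>p. vjoin (fst p) (snd p))"
    unfolding vjoin_def
  proof (rule continuous_on_vec_lambda)
    show "continuous_on UNIV (\<lambda>p. case i of Inl k \<Rightarrow> fst p $ k | Inr k \<Rightarrow> snd p $ k)" for i
      by (cases i) (simp_all add: continuous_on_component continuous_on_fst continuous_on_snd)
  qed
  then show "(\<lambda>\<omega>. vjoin (U \<omega>) (Z \<omega>)) \<in> borel_measurable M"
    by (rule borel_measurable_continuous_Pair[OF assms[THEN square_integrable_measurable]])
  show "integrable M (\<lambda>\<omega>. (norm (U \<omega>))\<^sup>2 + (norm (Z \<omega>))\<^sup>2)"
    using assms by (simp add: square_integrable_def)
qed (simp add: norm_vjoin)

lemma integrable_outer:
  assumes "square_integrable M U" "square_integrable M Z"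
  shows "integrable M (\<lambda>\<omega>. outer (U \<omega>) (Z \<omega>))"
proof (rule Bochner_Integration.integrable_bound)
  show "integrable M (\<lambda>\<omega>. (norm (U \<omega>))\<^sup>2 + (norm (Z \<omega>))\<^sup>2)"
    using assms by (simp add: square_integrable_def)
  have "continuous_on UNIV (\<lambda>p. outer (fst p) (snd p))"
    by (intro bounded_bilinear.continuous_on[OF bounded_bilinear_outer] continuous_intros)
  then show "(\<lambda>\<omega>. outer (U \<omega>) (Z \<omega>)) \<in> borel_measurable M"
    by (rule borel_measurable_continuous_Pair[OF assms[THEN square_integrable_measurable]])
  have "x * y \<le> \<bar>x\<^sup>2 + y\<^sup>2\<bar>" if "0 \<le> x" "0 \<le> y" for x y :: real
    using zero_le_power2[of "x - y"] mult_nonneg_nonneg[OF that] by (simp add: power2_diff)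
  then show "AE \<omega> in M. norm (outer (U \<omega>) (Z \<omega>)) \<le> norm ((norm (U \<omega>))\<^sup>2 + (norm (Z \<omega>))\<^sup>2)"
    by (simp add: norm_outer)
qed

lemma cross_moment_transpose:
  fixes U :: "'s \<Rightarrow> real^'a" and Z :: "'s \<Rightarrow> real^'b"
  assumes "square_integrable M U" "square_integrable M Z"
  shows "transpose (cross_moment M U Z) = cross_moment M Z U"
proof -
  have "linear (transpose :: real^'b^'a \<Rightarrow> real^'a^'b)"
    by (intro linearI) (simp_all add: transpose_add transpose_scalar)
  from integral_linear[OF this integrable_outer[OF assms]]
  show ?thesis by (simp add: cross_moment_def transpose_outer)
qed

lemma cross_moment_add_left:
  assumes "square_integrable M U" "square_integrable M U'" "square_integrable M Z"
  shows "cross_moment M (\<lambda>\<omega>. U \<omega> + U' \<omega>) Z = cross_moment M U Z + cross_moment M U' Z"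
  unfolding cross_moment_def outer_simps
  by (intro Bochner_Integration.integral_add integrable_outer assms)

lemma cross_moment_add_right:
  assumes "square_integrable M U" "square_integrable M Z" "square_integrable M Z'"
  shows "cross_moment M U (\<lambda>\<omega>. Z \<omega> + Z' \<omega>) = cross_moment M U Z + cross_moment M U Z'"
  unfolding cross_moment_def outer_simps
  by (intro Bochner_Integration.integral_add integrable_outer assms)

lemma cross_moment_diff_left:
  assumes "square_integrable M U" "square_integrable M U'" "square_integrable M Z"
  shows "cross_moment M (\<lambda>\<omega>. U \<omega> - U' \<omega>) Z = cross_moment M U Z - cross_moment M U' Z"
  unfolding cross_moment_def outer_simps
  by (intro Bochner_Integration.integral_diff integrable_outer assms)

lemma cross_moment_diff_right:
  assumes "square_integrable M U" "square_integrable M Z" "square_integrable M Z'"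
  shows "cross_moment M U (\<lambda>\<omega>. Z \<omega> - Z' \<omega>) = cross_moment M U Z - cross_moment M U Z'"
  unfolding cross_moment_def outer_simps
  by (intro Bochner_Integration.integral_diff integrable_outer assms)

lemma cross_moment_matrix_mult_left:
  fixes A :: "real^'a^'b" and Z :: "'s \<Rightarrow> real^'c"
  assumes "square_integrable M U" "square_integrable M Z"
  shows "cross_moment M (\<lambda>\<omega>. A *v U \<omega>) Z = A ** cross_moment M U Z"
proof -
  have "linear (\<lambda>S :: real^'c^'a. A ** S)"
    by (intro linearI) (simp_all add: matrix_add_ldistrib matrix_scaleR_right)
  from integral_linear[OF this integrable_outer[OF assms]]
  show ?thesis by (simp add: cross_moment_def matrix_vector_mult_outer)
qed

lemma cross_moment_matrix_mult_right:
  fixes A :: "real^'a^'b"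
  assumes "square_integrable M U" "square_integrable M Z"
  shows "cross_moment M U (\<lambda>\<omega>. A *v Z \<omega>) = cross_moment M U Z ** transpose A"
proof -
  have "cross_moment M U (\<lambda>\<omega>. A *v Z \<omega>) = transpose (cross_moment M (\<lambda>\<omega>. A *v Z \<omega>) U)"
    by (simp add: cross_moment_transpose assms square_integrable_matrix_mult)
  also have "\<dots> = cross_moment M U Z ** transpose A"
    by (simp add: cross_moment_matrix_mult_left assms matrix_transpose_mul cross_moment_transpose)
  finally show ?thesis .
qed

lemma inner_cross_moment:
  assumes "square_integrable M U" "square_integrable M Z"
  shows "cross_moment M U Z \<bullet> D = (\<integral>\<omega>. U \<omega> \<bullet> (D *v Z \<omega>) \<partial>M)"
    and "integrable M (\<lambda>\<omega>. U \<omega> \<bullet> (D *v Z \<omega>))"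
  using integrable_outer[OF assms]
  by (simp_all add: cross_moment_def flip: inner_outer)

lemma cross_moment_quadratic_form:
  assumes "square_integrable M U" "square_integrable M Z"
  shows "u \<bullet> (cross_moment M U Z *v v) = (\<integral>\<omega>. (u \<bullet> U \<omega>) * (v \<bullet> Z \<omega>) \<partial>M)"
proof -
  have "u \<bullet> (cross_moment M U Z *v v) = cross_moment M U Z \<bullet> outer u v"
    by (simp only: inner_commute[of "cross_moment M U Z"] inner_outer)
  also have "\<dots> = (\<integral>\<omega>. (u \<bullet> U \<omega>) * (v \<bullet> Z \<omega>) \<partial>M)"
    unfolding inner_cross_moment[OF assms] outer_vector_mult
    by (simp add: inner_commute mult.commute)
  finally show ?thesis .
qed

lemma cross_moment_psd:
  assumes "square_integrable M U"
  shows "0 \<le> u \<bullet> (cross_moment M U U *v u)"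
  unfolding cross_moment_quadratic_form[OF assms assms] by simp

lemma integrable_mult_functionals:
  assumes "square_integrable M U" "square_integrable M Z"
  shows "integrable M (\<lambda>\<omega>. (u \<bullet> U \<omega>) * (v \<bullet> Z \<omega>))"
  using inner_cross_moment(2)[OF assms, of "outer u v"]
  by (simp add: outer_vector_mult inner_commute mult.commute)

lemma cross_moment_vjoin:
  assumes "square_integrable M U" "square_integrable M Z"
    "square_integrable M U'" "square_integrable M Z'"
  shows "cross_moment M (\<lambda>\<omega>. vjoin (U \<omega>) (Z \<omega>)) (\<lambda>\<omega>. vjoin (U' \<omega>) (Z' \<omega>)) =
    block_mat (cross_moment M U U') (cross_moment M U Z') (cross_moment M Z U') (cross_moment M Z Z')"
    (is "?L = ?R")
proof -
  have "p \<bullet> (?L *v q) = p \<bullet> (?R *v q)" for p q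
  proof -
    obtain a b c d where pq: "p = vjoin a b" "q = vjoin c d"
      by (metis vjoin_vtop_vbot)
    show ?thesis
      unfolding pq block_mat_vector_mult inner_vjoin inner_add_right
      by (subst cross_moment_quadratic_form)
        (simp_all add: assms square_integrable_vjoin inner_vjoin distrib_left distrib_right
          cross_moment_quadratic_form integrable_mult_functionals)
  qed
  then have "?L *v q = ?R *v q" for q using vector_eq_ldot by blast
  then show ?thesis by (simp add: matrix_eq)
qed

lemma cross_moment_vjoin_right:
  assumes "square_integrable M U" "square_integrable M Z" "square_integrable M Z'"
  shows "cross_moment M U (\<lambda>\<omega>. vjoin (Z \<omega>) (Z' \<omega>)) = hcat (cross_moment M U Z, cross_moment M U Z')"
    (is "?L = ?R")
proof -
  have "p \<bullet> (?L *v q) = p \<bullet> (?R *v q)" for p q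
  proof -
    obtain c d where q: "q = vjoin c d" by (metis vjoin_vtop_vbot)
    show ?thesis
      unfolding q hcat_vjoin inner_add_right fst_conv snd_conv
      by (subst cross_moment_quadratic_form)
        (simp_all add: assms square_integrable_vjoin inner_vjoin distrib_left
          cross_moment_quadratic_form integrable_mult_functionals)
  qed
  then have "?L *v q = ?R *v q" for q using vector_eq_ldot by blast
  then show ?thesis by (simp add: matrix_eq)
qed

context prob_space
begin

lemma square_integrable_const: "square_integrable M (\<lambda>_. c)"
  by (simp add: square_integrable_def)

lemma square_integrable_imp_integrable:
  assumes "square_integrable M U"
  shows "integrable M U"
proof (rule Bochner_Integration.integrable_bound)
  show "integrable M (\<lambda>\<omega>. 1 + (norm (U \<omega>))\<^sup>2)"
    using assms by (simp add: square_integrable_def)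
  have "x \<le> 1 + x\<^sup>2" for x :: real
    using zero_le_power2[of "x - 1"] zero_le_power2[of x]
    unfolding power2_diff by (simp only: mult_1_right one_power2)
  then show "AE \<omega> in M. norm (U \<omega>) \<le> norm (1 + (norm (U \<omega>))\<^sup>2)"
    by (simp add: abs_of_nonneg)
qed (use assms in \<open>simp add: square_integrable_def\<close>)

lemma cross_moment_const_left:
  assumes "square_integrable M Z"
  shows "cross_moment M (\<lambda>_. c) Z = outer c (\<integral>\<omega>. Z \<omega> \<partial>M)"
  unfolding cross_moment_def
  by (rule integral_bounded_linear[OF bounded_bilinear.bounded_linear_right[OF bounded_bilinear_outer]
        square_integrable_imp_integrable[OF assms]])

lemma cross_moment_const_right:
  assumes "square_integrable M Z"
  shows "cross_moment M Z (\<lambda>_. c) = outer (\<integral>\<omega>. Z \<omega> \<partial>M) c"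
  using cross_moment_const_left[OF assms, of c]
    cross_moment_transpose[OF square_integrable_const assms, of c]
  by (simp add: transpose_outer)

end

section \<open>Moments of Gaussian and of independent vectors\<close>

context prob_space
begin

lemma gaussian_vec_functional:
  assumes X: "gaussian_vec M X \<mu> S"
  shows "integrable M (\<lambda>\<omega>. u \<bullet> X \<omega>)"
    and "(\<integral>\<omega>. u \<bullet> X \<omega> \<partial>M) = u \<bullet> \<mu>"
    and "integrable M (\<lambda>\<omega>. (u \<bullet> X \<omega>)\<^sup>2)"
    and "(\<integral>\<omega>. (u \<bullet> X \<omega> - u \<bullet> \<mu>)\<^sup>2 \<partial>M) = u \<bullet> (S *v u)"
proof -
  have "integrable M (\<lambda>\<omega>. u \<bullet> X \<omega>) \<and> (\<integral>\<omega>. u \<bullet> X \<omega> \<partial>M) = u \<bullet> \<mu> \<and>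
    integrable M (\<lambda>\<omega>. (u \<bullet> X \<omega>)\<^sup>2) \<and> (\<integral>\<omega>. (u \<bullet> X \<omega> - u \<bullet> \<mu>)\<^sup>2 \<partial>M) = u \<bullet> (S *v u)"
  proof (cases "u = 0")
    case False
    define m \<sigma> where "m = u \<bullet> \<mu>" and "\<sigma> = sqrt (u \<bullet> (S *v u))"
    have pos: "0 < u \<bullet> (S *v u)" using X False by (simp add: gaussian_vec_def posdef_def)
    then have \<sigma>: "0 < \<sigma>" "\<sigma>\<^sup>2 = u \<bullet> (S *v u)" by (simp_all add: \<sigma>_def)
    have D: "distributed M lborel (\<lambda>\<omega>. u \<bullet> X \<omega>) (normal_density m \<sigma>)"
      using X False by (simp add: gaussian_vec_def m_def \<sigma>_def)
    have central: "integrable M (\<lambda>\<omega>. (u \<bullet> X \<omega> - m) ^ k)" for k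
      using distributed_integrable[OF D, of "\<lambda>x. (x - m) ^ k"] integrable_normal_moment[OF \<sigma>(1), of m k]
      by simp
    have i1: "integrable M (\<lambda>\<omega>. u \<bullet> X \<omega>)"
      using Bochner_Integration.integrable_add[OF central[of 1] integrable_const[of m]] by simp
    have E: "(\<integral>\<omega>. u \<bullet> X \<omega> \<partial>M) = m"
      by (rule normal_distributed_expectation[OF \<sigma>(1) D])
    have "integrable M (\<lambda>\<omega>. (u \<bullet> X \<omega> - m)\<^sup>2 + 2 * m * (u \<bullet> X \<omega>) - m\<^sup>2)"
      using central[of 2] i1 by (intro Bochner_Integration.integrable_diff
          Bochner_Integration.integrable_add integrable_mult_right integrable_const)
    also have "(\<lambda>\<omega>. (u \<bullet> X \<omega> - m)\<^sup>2 + 2 * m * (u \<bullet> X \<omega>) - m\<^sup>2) = (\<lambda>\<omega>. (u \<bullet> X \<omega>)\<^sup>2)"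
      by (simp add: power2_eq_square algebra_simps)
    finally show ?thesis
      using i1 E normal_distributed_variance[OF \<sigma>(1) D] by (simp add: \<sigma>(2) m_def)
  qed simp
  then show "integrable M (\<lambda>\<omega>. u \<bullet> X \<omega>)"
    and "(\<integral>\<omega>. u \<bullet> X \<omega> \<partial>M) = u \<bullet> \<mu>"
    and "integrable M (\<lambda>\<omega>. (u \<bullet> X \<omega>)\<^sup>2)"
    and "(\<integral>\<omega>. (u \<bullet> X \<omega> - u \<bullet> \<mu>)\<^sup>2 \<partial>M) = u \<bullet> (S *v u)"
    by auto
qed

lemma gaussian_vec_square_integrable:
  assumes X: "gaussian_vec M X \<mu> S"
  shows "square_integrable M X"
  unfolding square_integrable_def
proof
  show "X \<in> borel_measurable M" using X by (simp add: gaussian_vec_def)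
  have "(norm (X \<omega>))\<^sup>2 = (\<Sum>i\<in>UNIV. (axis i 1 \<bullet> X \<omega>)\<^sup>2)" for \<omega>
    unfolding power2_norm_eq_inner inner_axis' by (simp add: inner_vec_def power2_eq_square)
  then show "integrable M (\<lambda>\<omega>. (norm (X \<omega>))\<^sup>2)"
    by (simp add: gaussian_vec_functional(3)[OF X])
qed

lemma gaussian_vec_mean:
  assumes X: "gaussian_vec M X \<mu> S"
  shows "(\<integral>\<omega>. X \<omega> \<partial>M) = \<mu>"
proof -
  have "integrable M X"
    using X by (intro square_integrable_imp_integrable gaussian_vec_square_integrable)
  then have "u \<bullet> (\<integral>\<omega>. X \<omega> \<partial>M) = u \<bullet> \<mu>" for u
    by (simp flip: gaussian_vec_functional(2)[OF X])
  then show ?thesis using vector_eq_ldot by blast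
qed

lemma gaussian_vec_covariance:
  assumes X: "gaussian_vec M X \<mu> S"
  shows "cross_moment M (\<lambda>\<omega>. X \<omega> - \<mu>) (\<lambda>\<omega>. X \<omega> - \<mu>) = S"
proof -
  have si: "square_integrable M (\<lambda>\<omega>. X \<omega> - \<mu>)"
    using X by (intro square_integrable_diff square_integrable_const gaussian_vec_square_integrable)
  show ?thesis
  proof (rule symmetric_matrix_eqI)
    show "transpose S = S" using X by (simp add: gaussian_vec_def posdef_def)
    show "u \<bullet> (cross_moment M (\<lambda>\<omega>. X \<omega> - \<mu>) (\<lambda>\<omega>. X \<omega> - \<mu>) *v u) = u \<bullet> (S *v u)" for u
      unfolding cross_moment_quadratic_form[OF si si]
      by (simp add: inner_diff_right gaussian_vec_functional(4)[OF X, symmetric] power2_eq_square)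
  qed (rule cross_moment_transpose[OF si si])
qed

text \<open>Independence of \<open>U\<close> and \<open>Z\<close>, which may have different dimensions, is stated through the
  generated sigma-algebras; it is used through the scalar functionals \<open>u \<bullet> U\<close> and \<open>v \<bullet> Z\<close>.\<close>
lemma cross_moment_indep:
  assumes ind: "indep_set (sets (vimage_algebra (space M) U borel)) (sets (vimage_algebra (space M) Z borel))"
    and U: "square_integrable M U" and Z: "square_integrable M Z"
  shows "cross_moment M U Z = outer (\<integral>\<omega>. U \<omega> \<partial>M) (\<integral>\<omega>. Z \<omega> \<partial>M)"
proof -
  have generated: "sigma_sets (space M) {(\<lambda>\<omega>. u \<bullet> F \<omega>) -` B \<inter> space M | B. B \<in> sets borel}
      \<subseteq> sets (vimage_algebra (space M) F borel)" for F :: "'a \<Rightarrow> real^'k" and u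
  proof -
    have [measurable]: "F \<in> borel_measurable (vimage_algebra (space M) F borel)"
      by (rule measurable_vimage_algebra1) simp
    have "(\<lambda>\<omega>. u \<bullet> F \<omega>) \<in> borel_measurable (vimage_algebra (space M) F borel)"
      by measurable
    from measurable_sets[OF this] have "{(\<lambda>\<omega>. u \<bullet> F \<omega>) -` B \<inter> space M | B. B \<in> sets borel}
        \<subseteq> sets (vimage_algebra (space M) F borel)"
      by auto
    then show ?thesis
      using sets.sigma_sets_subset[of _ "vimage_algebra (space M) F borel"] by simp
  qed
  have "u \<bullet> (cross_moment M U Z *v v) = u \<bullet> (outer (\<integral>\<omega>. U \<omega> \<partial>M) (\<integral>\<omega>. Z \<omega> \<partial>M) *v v)" for u v
  proof -
    note [measurable] = square_integrable_measurable[OF U] square_integrable_measurable[OF Z]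
    note iU = square_integrable_imp_integrable[OF U] and iZ = square_integrable_imp_integrable[OF Z]
    have "indep_var borel (\<lambda>\<omega>. u \<bullet> U \<omega>) borel (\<lambda>\<omega>. v \<bullet> Z \<omega>)"
      unfolding indep_var_eq
    proof (intro conjI)
      show "indep_set (sigma_sets (space M) {(\<lambda>\<omega>. u \<bullet> U \<omega>) -` B \<inter> space M | B. B \<in> sets borel})
          (sigma_sets (space M) {(\<lambda>\<omega>. v \<bullet> Z \<omega>) -` B \<inter> space M | B. B \<in> sets borel})"
        using ind generated[of u U] generated[of v Z] unfolding indep_sets2_eq by blast
    qed measurable
    then have "(\<integral>\<omega>. (u \<bullet> U \<omega>) * (v \<bullet> Z \<omega>) \<partial>M) = (\<integral>\<omega>. u \<bullet> U \<omega> \<partial>M) * (\<integral>\<omega>. v \<bullet> Z \<omega> \<partial>M)"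
      using iU iZ by (intro indep_var_lebesgue_integral) auto
    then show ?thesis
      using iU iZ unfolding cross_moment_quadratic_form[OF U Z]
      by (simp add: outer_vector_mult inner_commute mult.commute)
  qed
  then have "cross_moment M U Z *v v = outer (\<integral>\<omega>. U \<omega> \<partial>M) (\<integral>\<omega>. Z \<omega> \<partial>M) *v v" for v
    using vector_eq_ldot by blast
  then show ?thesis by (simp add: matrix_eq)
qed

lemma indep_sets_imp_indep_set:
  assumes "indep_sets F I" "i \<in> I" "j \<in> I" "i \<noteq> j"
  shows "indep_set (F i) (F j)"
  unfolding indep_sets2_eq
proof (intro conjI ballI)
  show "F i \<subseteq> events" "F j \<subseteq> events" using assms by (auto simp: indep_sets_def)
  fix a b assume "a \<in> F i" "b \<in> F j"
  then show "prob (a \<inter> b) = prob a * prob b"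
    using indep_setsD[OF assms(1), of "{i, j}" "\<lambda>k. if k = i then a else b"] assms(2-4)
    by (simp add: Int_commute)
qed

end

section \<open>The Kalman filter for uncorrelated noise\<close>

lemma posdef_add_congruence:
  fixes C :: "real^'n^'m"
  assumes V: "posdef V" and S: "transpose S = S" "\<And>u. 0 \<le> u \<bullet> (S *v u)"
  shows "posdef (V + C ** S ** transpose C)"
  unfolding posdef_def
proof (intro conjI allI impI)
  show "transpose (V + C ** S ** transpose C) = V + C ** S ** transpose C"
    using V S(1) by (simp add: posdef_def transpose_add matrix_transpose_mul matrix_mul_assoc)
  fix b :: "real^'m" assume "b \<noteq> 0"
  have "b \<bullet> ((V + C ** S ** transpose C) *v b)
      = b \<bullet> (V *v b) + (transpose C *v b) \<bullet> (S *v (transpose C *v b))"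
    by (simp add: matrix_vector_mult_add_rdistrib inner_add_right inner_matrix_vector_mult[of b C]
        flip: matrix_vector_mul_assoc del: transpose_matrix_vector)
  then show "0 < b \<bullet> ((V + C ** S ** transpose C) *v b)"
    using V \<open>b \<noteq> 0\<close> S(2)[of "transpose C *v b"] by (simp add: posdef_def add_pos_nonneg)
qed

text \<open>The filtering problem with all that the argument needs of the noise: square integrability, the
  means, the covariances, and uncorrelated sources. No Gaussian law is assumed, and \<open>\<Theta>\<close> need not
  be positive definite.\<close>
locale filtering_problem = prob_space M for M :: "'s measure" +
  fixes A W X0 \<Theta> :: "real^'n^'n" and C :: "real^'n^'m" and V :: "real^'m^'m"
    and m0 :: "real^'n"
    and \<xi> \<theta> :: "'s \<Rightarrow> real^'n" and w :: "nat \<Rightarrow> 's \<Rightarrow> real^'n" and v :: "nat \<Rightarrow> 's \<Rightarrow> real^'m"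
  assumes posdef_V: "posdef V"
    and square_integrable_sources:
      "square_integrable M \<xi>" "square_integrable M \<theta>"
      "square_integrable M (w t)" "square_integrable M (v t)"
    and means: "(\<integral>\<omega>. \<xi> \<omega> \<partial>M) = m0" "(\<integral>\<omega>. \<theta> \<omega> \<partial>M) = 0"
      "(\<integral>\<omega>. w t \<omega> \<partial>M) = 0" "(\<integral>\<omega>. v t \<omega> \<partial>M) = 0"
    and covariances: "cross_moment M (\<lambda>\<omega>. \<xi> \<omega> - m0) (\<lambda>\<omega>. \<xi> \<omega> - m0) = X0"
      "cross_moment M \<theta> \<theta> = \<Theta>" "cross_moment M (w t) (w t) = W" "cross_moment M (v t) (v t) = V"
    and uncorrelated: "cross_moment M \<xi> \<theta> = 0" "cross_moment M \<xi> (w t) = 0"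
      "cross_moment M \<xi> (v t) = 0"
      "cross_moment M (w t) \<theta> = 0" "cross_moment M (v t) \<theta> = 0" "cross_moment M (w s) (v t) = 0"
      "s \<noteq> t \<Longrightarrow> cross_moment M (w s) (w t) = 0" "s \<noteq> t \<Longrightarrow> cross_moment M (v s) (v t) = 0"
begin

lemma uncorrelated_sym:
  "cross_moment M \<theta> (w t) = 0" "cross_moment M \<theta> (v t) = 0" "cross_moment M (v t) (w s) = 0"
  by (metis cross_moment_transpose square_integrable_sources uncorrelated transpose_zero)+

text \<open>The filter gains, the covariances of the Riccati recursion, and the state covariances.\<close>
abbreviation "L \<equiv> kalman_L A C W V X0"
abbreviation "S \<equiv> kalman_cov A C W V X0"
abbreviation "X \<equiv> state_cov A W X0"

text \<open>State and estimate without the perturbation \<open>\<theta>\<close>, and the estimation error.\<close>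
definition x where "x = state A \<xi> (\<lambda>_. 0) w 0"
definition xh where "xh = estimate A C L m0 \<xi> (\<lambda>_. 0) w v 0"
definition e where "e t \<omega> = x t \<omega> - xh t \<omega>"

text \<open>The mean of the state, which is also the mean of the estimate.\<close>
definition \<mu> where "\<mu> t = (\<integral>\<omega>. x t \<omega> \<partial>M)"

text \<open>The transition matrix of the estimation error and the noise that drives it.\<close>
definition F where "F t = A - L t ** C"
definition n where "n t \<omega> = w t \<omega> - L t *v v t \<omega>"

lemma x_0: "x 0 = \<xi>" by (simp add: x_def fun_eq_iff)
lemma x_Suc: "x (Suc t) = (\<lambda>\<omega>. A *v x t \<omega> + w t \<omega>)" by (simp add: x_def fun_eq_iff)

lemma xh_0: "xh 0 = (\<lambda>\<omega>. m0)" by (simp add: xh_def fun_eq_iff)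
lemma xh_Suc: "xh (Suc t) = (\<lambda>\<omega>. A *v xh t \<omega> + L t *v (C *v e t \<omega> + v t \<omega>))"
  by (simp add: xh_def x_def e_def measurement_def fun_eq_iff matrix_vector_mult_diff_rdistrib
      matrix_vector_right_distrib matrix_vector_mult_diff_distrib flip: matrix_vector_mul_assoc)

lemma e_0: "e 0 = (\<lambda>\<omega>. \<xi> \<omega> - m0)" by (simp add: e_def x_0 xh_0 fun_eq_iff)
lemma e_Suc: "e (Suc t) = (\<lambda>\<omega>. F t *v e t \<omega> + n t \<omega>)"
  unfolding e_def[of "Suc t"] x_Suc xh_Suc
  by (simp add: F_def n_def e_def fun_eq_iff matrix_vector_mult_diff_rdistrib
      matrix_vector_right_distrib matrix_vector_mult_diff_distrib flip: matrix_vector_mul_assoc)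

lemma xh_eq: "xh t = (\<lambda>\<omega>. x t \<omega> - e t \<omega>)" by (simp add: e_def fun_eq_iff)
lemma x_eq: "x t = (\<lambda>\<omega>. xh t \<omega> + e t \<omega>)" by (simp add: e_def fun_eq_iff)
lemma n_eq: "n t = (\<lambda>\<omega>. w t \<omega> - L t *v v t \<omega>)" by (simp add: n_def fun_eq_iff)

lemmas square_integrable_closure = square_integrable_add square_integrable_diff
  square_integrable_matrix_mult square_integrable_const square_integrable_vjoin

lemma square_integrable_x: "square_integrable M (x t)"
  by (induction t) (simp_all add: x_0 x_Suc square_integrable_closure square_integrable_sources)

lemma square_integrable_e: "square_integrable M (e t)"
  by (induction t) (simp_all add: e_0 e_Suc n_def square_integrable_closure square_integrable_sources)

lemma square_integrable_xh: "square_integrable M (xh t)"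
  unfolding xh_eq by (intro square_integrable_diff square_integrable_x square_integrable_e)

lemma square_integrable_n: "square_integrable M (n t)"
  by (simp add: n_eq square_integrable_closure square_integrable_sources)

lemmas square_integrable_process = square_integrable_closure square_integrable_sources
  square_integrable_x square_integrable_e square_integrable_xh square_integrable_n

lemmas moment_simps =
  cross_moment_add_left cross_moment_add_right cross_moment_diff_left cross_moment_diff_right
  cross_moment_matrix_mult_left cross_moment_matrix_mult_right square_integrable_process

text \<open>A centred vector that is uncorrelated with \<open>\<xi>\<close> and with the noise before time \<open>t\<close> is
  uncorrelated with the state, the error and the estimate at time \<open>t\<close>.\<close>
lemma uncorrelated_with_past:
  assumes U: "square_integrable M U" "(\<integral>\<omega>. U \<omega> \<partial>M) = 0" and "cross_moment M \<xi> U = 0"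
    and "\<And>s. s < t \<Longrightarrow> cross_moment M (w s) U = 0" "\<And>s. s < t \<Longrightarrow> cross_moment M (v s) U = 0"
  shows "cross_moment M (x t) U = 0 \<and> cross_moment M (e t) U = 0 \<and> cross_moment M (xh t) U = 0"
proof -
  have "cross_moment M (x t) U = 0 \<and> cross_moment M (e t) U = 0"
    using assms(4,5)
  proof (induction t)
    case 0
    have "outer m0 0 = 0" by (simp add: outer_def vec_eq_iff)
    then show ?case
      by (simp add: x_0 e_0 moment_simps U assms(3) cross_moment_const_left)
  next
    case (Suc t)
    then have "cross_moment M (x t) U = 0" "cross_moment M (e t) U = 0"
      "cross_moment M (w t) U = 0" "cross_moment M (v t) U = 0" by simp_all
    then show ?case by (simp add: x_Suc e_Suc n_eq moment_simps U)
  qed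
  then show ?thesis by (simp add: xh_eq moment_simps U)
qed

lemma uncorrelated_future:
  "cross_moment M (x t) \<theta> = 0" "cross_moment M (e t) \<theta> = 0" "cross_moment M (xh t) \<theta> = 0"
  "cross_moment M (x t) (w t) = 0" "cross_moment M (e t) (w t) = 0" "cross_moment M (xh t) (w t) = 0"
  "cross_moment M (x t) (v t) = 0" "cross_moment M (e t) (v t) = 0" "cross_moment M (xh t) (v t) = 0"
  using uncorrelated_with_past[of \<theta> t] uncorrelated_with_past[of "w t" t]
    uncorrelated_with_past[of "v t" t]
  by (simp_all add: square_integrable_sources means uncorrelated uncorrelated_sym)

lemma uncorrelated_future_sym:
  "cross_moment M \<theta> (x t) = 0" "cross_moment M \<theta> (e t) = 0" "cross_moment M \<theta> (xh t) = 0"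
  "cross_moment M (w t) (x t) = 0" "cross_moment M (w t) (e t) = 0" "cross_moment M (w t) (xh t) = 0"
  "cross_moment M (v t) (x t) = 0" "cross_moment M (v t) (e t) = 0" "cross_moment M (v t) (xh t) = 0"
  by (metis cross_moment_transpose square_integrable_process uncorrelated_future transpose_zero)+

lemmas uncorrelated_simps = uncorrelated uncorrelated_sym uncorrelated_future uncorrelated_future_sym

lemma mean_matrix_mult:
  fixes B :: "real^'a^'b"
  shows "square_integrable M U \<Longrightarrow> (\<integral>\<omega>. B *v U \<omega> \<partial>M) = B *v (\<integral>\<omega>. U \<omega> \<partial>M)"
  by (simp add: integral_bounded_linear square_integrable_imp_integrable)

lemma integrable_process: "integrable M (x t)" "integrable M (xh t)" "integrable M (e t)"
  "integrable M (w t)" "integrable M (v t)" "integrable M \<theta>" "integrable M \<xi>" "integrable M (n t)"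
  by (intro square_integrable_imp_integrable square_integrable_process)+

lemma mean_e: "(\<integral>\<omega>. e t \<omega> \<partial>M) = 0"
proof (induction t)
  case 0
  show ?case by (simp add: e_0 means integrable_process prob_space)
next
  case (Suc t)
  have "(\<integral>\<omega>. n t \<omega> \<partial>M) = 0"
    by (simp add: n_eq means mean_matrix_mult square_integrable_process integrable_process
        square_integrable_imp_integrable)
  then show ?case
    by (simp add: e_Suc Suc mean_matrix_mult square_integrable_process integrable_process
        square_integrable_imp_integrable)
qed

lemma mean_xh: "(\<integral>\<omega>. xh t \<omega> \<partial>M) = \<mu> t"
  unfolding xh_eq by (simp add: \<mu>_def mean_e integrable_process)

lemma \<mu>_0: "\<mu> 0 = m0" by (simp add: \<mu>_def x_0 means)

lemma \<mu>_Suc: "\<mu> (Suc t) = A *v \<mu> t"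
  by (simp add: \<mu>_def x_Suc means mean_matrix_mult square_integrable_process integrable_process
      square_integrable_imp_integrable)

lemma outer_congruence: "A ** outer a a ** transpose A = outer (A *v a) (A *v a)"
  by (metis matrix_vector_mult_outer transpose_outer matrix_transpose_mul matrix_mul_assoc)

lemma second_moment_x: "cross_moment M (x t) (x t) = X t + outer (\<mu> t) (\<mu> t)"
proof (induction t)
  case 0
  have "cross_moment M \<xi> \<xi> - outer m0 m0 = X0"
    using covariances(1)
    by (simp add: moment_simps cross_moment_const_left cross_moment_const_right prob_space means)
  then show ?case by (simp add: x_0 \<mu>_0 algebra_simps)
next
  case (Suc t)
  show ?case
    by (simp add: x_Suc moment_simps uncorrelated_simps Suc covariances \<mu>_Suc matrix_add_ldistrib
        matrix_add_rdistrib matrix_mul_assoc flip: outer_congruence)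
qed

lemma innovation_covariance_posdef:
  assumes "cross_moment M (e t) (e t) = S t"
  shows "posdef (V + C ** S t ** transpose C)"
  using posdef_add_congruence[OF posdef_V] cross_moment_psd[OF square_integrable_e[of t]]
    cross_moment_transpose[OF square_integrable_e[of t] square_integrable_e[of t]] assms
  by metis

text \<open>The normal equation of the gain, \<open>L (V + C S C\<^sup>T) = A S C\<^sup>T\<close>, solved for \<open>L V\<close>.\<close>
lemma gain_equation:
  assumes "cross_moment M (e t) (e t) = S t"
  shows "L t ** V = F t ** S t ** transpose C"
proof -
  let ?R = "V + C ** S t ** transpose C"
  have "L t ** ?R = A ** S t ** transpose C ** (matrix_inv ?R ** ?R)"
    by (simp only: kalman_L_def kalman_gain_def matrix_mul_assoc)
  also have "\<dots> = A ** S t ** transpose C"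
    by (simp add: posdef_matrix_inv_left innovation_covariance_posdef assms)
  finally show ?thesis
    by (simp add: F_def matrix_add_ldistrib matrix_diff_rdistrib matrix_mul_assoc algebra_simps)
qed

text \<open>The two invariants of the filter: the error covariance solves the Riccati recursion, and the
  error is orthogonal to the estimate.\<close>
lemma error_moments:
  "cross_moment M (e t) (e t) = S t \<and> cross_moment M (e t) (xh t) = 0"
proof (induction t)
  case 0
  have "outer 0 m0 = 0" by (simp add: outer_def vec_eq_iff)
  then have "cross_moment M (e 0) (xh 0) = 0"
    using mean_e[of 0] by (simp add: xh_0 cross_moment_const_right square_integrable_e)
  then show ?case using covariances(1) by (simp add: e_0)
next
  case (Suc t)
  then have ee: "cross_moment M (e t) (e t) = S t" and exh: "cross_moment M (e t) (xh t) = 0"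
    by auto
  note gain = gain_equation[OF ee]
  have "cross_moment M (e (Suc t)) (e (Suc t))
      = F t ** S t ** transpose (F t) + W + L t ** V ** transpose (L t)"
    by (simp add: e_Suc n_eq moment_simps uncorrelated_simps covariances ee matrix_mul_assoc)
  also have "\<dots> = F t ** S t ** transpose A + W"
    by (simp add: gain) (simp add: F_def transpose_diff matrix_transpose_mul matrix_diff_ldistrib
        matrix_mul_assoc)
  also have "\<dots> = S (Suc t)"
    by (simp add: F_def matrix_diff_rdistrib Let_def kalman_L_def kalman_gain_def matrix_mul_assoc)
  finally have 1: "cross_moment M (e (Suc t)) (e (Suc t)) = S (Suc t)" .
  have "cross_moment M (e (Suc t)) (xh (Suc t))
      = F t ** S t ** transpose C ** transpose (L t) - L t ** V ** transpose (L t)"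
    by (simp add: e_Suc xh_Suc n_eq moment_simps uncorrelated_simps covariances ee exh
        matrix_mul_assoc)
  then have "cross_moment M (e (Suc t)) (xh (Suc t)) = 0" by (simp add: gain)
  with 1 show ?case by simp
qed

lemmas second_moment_e = error_moments[THEN conjunct1]
lemmas error_orthogonal = error_moments[THEN conjunct2]

lemma error_orthogonal_sym: "cross_moment M (xh t) (e t) = 0"
  by (metis cross_moment_transpose square_integrable_process error_orthogonal transpose_zero)

lemma second_moment_xh:
  "cross_moment M (xh t) (xh t) = X t - S t + outer (\<mu> t) (\<mu> t)"
  "cross_moment M (xh t) (x t) = X t - S t + outer (\<mu> t) (\<mu> t)"
  "cross_moment M (x t) (xh t) = X t - S t + outer (\<mu> t) (\<mu> t)"
proof -
  have "cross_moment M (x t) (x t) = cross_moment M (xh t) (xh t) + S t"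
    unfolding x_eq
    by (simp add: moment_simps second_moment_e error_orthogonal error_orthogonal_sym)
  then show xh: "cross_moment M (xh t) (xh t) = X t - S t + outer (\<mu> t) (\<mu> t)"
    by (simp add: second_moment_x algebra_simps)
  show "cross_moment M (xh t) (x t) = X t - S t + outer (\<mu> t) (\<mu> t)"
    unfolding x_eq by (simp add: moment_simps error_orthogonal_sym xh)
  show "cross_moment M (x t) (xh t) = X t - S t + outer (\<mu> t) (\<mu> t)"
    unfolding x_eq by (simp add: moment_simps error_orthogonal xh)
qed


section \<open>The static objective as a quadratic function\<close>

lemma state_perturbed:
  "t \<le> h \<Longrightarrow> state A \<xi> \<theta> w h t \<omega> = x t \<omega> + (if t = h then \<theta> \<omega> else 0)"
  by (induction t) (auto simp: x_0 x_Suc)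

lemma estimate_perturbed:
  "t \<le> h \<Longrightarrow> estimate A C L m0 \<xi> \<theta> w v h t \<omega> = xh t \<omega> + (if t = h then \<theta> \<omega> else 0)"
proof (induction t)
  case 0
  then show ?case by (auto simp: xh_0)
next
  case (Suc t)
  then have "estimate A C L m0 \<xi> \<theta> w v h t \<omega> = xh t \<omega>" "state A \<xi> \<theta> w h t \<omega> = x t \<omega>"
    by (auto simp: state_perturbed)
  then show ?case
    by (auto simp: measurement_def xh_Suc e_def matrix_vector_mult_diff_rdistrib
        matrix_vector_right_distrib matrix_vector_mult_diff_distrib simp flip: matrix_vector_mul_assoc)
qed

text \<open>The regressor at time \<open>h\<close>: the perturbed estimate stacked on the perturbed output.\<close>
definition z where
  "z h \<omega> = vjoin (xh h \<omega> + \<theta> \<omega>) (C *v (x h \<omega> + \<theta> \<omega>) + v h \<omega>)"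

text \<open>The second moment matrix of the regressor, which is the Hessian matrix.\<close>
definition H where "H h = cross_moment M (z h) (z h)"

lemma z_eq: "z h = (\<lambda>\<omega>. vjoin (xh h \<omega> + \<theta> \<omega>) (C *v (x h \<omega> + \<theta> \<omega>) + v h \<omega>))"
  by (simp add: z_def fun_eq_iff)

lemma z_estimate_measurement:
  "z h \<omega> = vjoin (estimate A C L m0 \<xi> \<theta> w v h h \<omega>) (measurement A C \<xi> \<theta> w v h h \<omega>)"
  by (simp add: z_def measurement_def state_perturbed estimate_perturbed)

lemma square_integrable_z: "square_integrable M (z h)"
  by (simp add: z_eq square_integrable_process)

text \<open>The regressor is the sum of the uncorrelated parts \<open>(xh, C x)\<close> and \<open>(\<theta>, C \<theta> + v)\<close>. The
  second one has the moment matrix \<open>mean_block\<close> with zero means, which is positive definite.\<close>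
lemma H_eq_sum:
  "H h = cross_moment M (\<lambda>\<omega>. vjoin (xh h \<omega>) (C *v x h \<omega>)) (\<lambda>\<omega>. vjoin (xh h \<omega>) (C *v x h \<omega>))
    + mean_block C V \<Theta> 0 0"
proof -
  have "outer 0 0 = (0 :: real^'n^'n)" by (simp add: outer_def vec_eq_iff)
  then show ?thesis
    by (simp add: H_def z_eq cross_moment_vjoin moment_simps uncorrelated_simps covariances
        mean_block_def block_mat_add matrix_add_ldistrib matrix_add_rdistrib
        matrix_vector_right_distrib matrix_mul_assoc ac_simps)
qed

lemma H_eq: "H h = mean_block C V \<Theta> (\<mu> h) (\<mu> h) + past_cov_block C (X h) (X h - S h)"
  by (simp add: H_def z_eq cross_moment_vjoin moment_simps uncorrelated_simps covariances
      second_moment_x second_moment_xh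
      mean_block_def past_cov_block_def block_mat_add matrix_add_ldistrib matrix_add_rdistrib
      matrix_vector_right_distrib matrix_mul_assoc ac_simps)

lemma posdef_H:
  assumes "posdef \<Theta>"
  shows "posdef (H h)"
proof -
  have "0 < u \<bullet> (H h *v u)" if "u \<noteq> 0" for u
  proof -
    have "square_integrable M (\<lambda>\<omega>. vjoin (xh h \<omega>) (C *v x h \<omega>))"
      by (simp add: square_integrable_process)
    from cross_moment_psd[OF this, of u] show ?thesis
      using posdef_mean_block[OF posdef_V assms, of C 0 0] that
      by (simp add: H_eq_sum matrix_vector_mult_add_rdistrib inner_add_right posdef_def add_nonneg_pos)
  qed
  moreover have "transpose (H h) = H h"
    by (simp add: H_def cross_moment_transpose square_integrable_z)
  ultimately show ?thesis by (simp add: posdef_def)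
qed

text \<open>The Kalman policy as one matrix.\<close>
abbreviation "K h \<equiv> hcat (kalman_policy A C W V X0 h)"

text \<open>With the Kalman gains, \<open>e (h + 1)\<close> is the prediction error at time \<open>h + 1\<close> also in the presence
  of \<open>\<theta>\<close>, because \<open>\<theta>\<close> shifts the state and the estimate by the same amount.\<close>
lemma prediction_error:
  "state A \<xi> \<theta> w h (Suc h) \<omega> - hcat \<pi> *v z h \<omega>
    = e (Suc h) \<omega> - hcat (\<pi> - kalman_policy A C W V X0 h) *v z h \<omega>"
proof -
  have "state A \<xi> \<theta> w h (Suc h) \<omega> - K h *v z h \<omega> = e (Suc h) \<omega>"
    by (simp add: state_perturbed z_def hcat_vjoin kalman_policy_def e_Suc n_def F_def e_def
        matrix_vector_mult_diff_rdistrib matrix_vector_right_distrib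
        matrix_vector_mult_diff_distrib flip: matrix_vector_mul_assoc)
  then show ?thesis
    by (simp add: hcat_diff matrix_vector_mult_diff_rdistrib algebra_simps)
qed

text \<open>The normal equation of the least squares problem at time \<open>h\<close>.\<close>
lemma prediction_error_orthogonal: "cross_moment M (e (Suc h)) (z h) = 0"
proof -
  have ex: "cross_moment M (e h) (x h) = S h"
    unfolding x_eq by (simp add: moment_simps second_moment_e error_orthogonal)
  show ?thesis
    by (simp add: hcat_zero[unfolded zero_prod_def] z_eq cross_moment_vjoin_right e_Suc n_eq moment_simps uncorrelated_simps
        covariances second_moment_e error_orthogonal ex gain_equation matrix_mul_assoc)
qed

text \<open>The static objective at time \<open>h\<close>, as a function of the policy.\<close>
definition J where "J h = objective M A C L m0 \<xi> \<theta> w v h"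

lemma cost_eq:
  "cost A C L m0 \<xi> \<theta> w v h \<pi> \<omega> = (\<Sum>t\<le>h. (norm (e t \<omega>))\<^sup>2)
    + (norm (e (Suc h) \<omega> - hcat (\<pi> - kalman_policy A C W V X0 h) *v z h \<omega>))\<^sup>2"
proof -
  have "state A \<xi> \<theta> w h t \<omega> - estimate A C L m0 \<xi> \<theta> w v h t \<omega> = e t \<omega>" if "t \<le> h" for t
    using that by (simp add: state_perturbed estimate_perturbed e_def)
  then have "(\<Sum>t\<le>h. (state A \<xi> \<theta> w h t \<omega> - estimate A C L m0 \<xi> \<theta> w v h t \<omega>)
      \<bullet> (state A \<xi> \<theta> w h t \<omega> - estimate A C L m0 \<xi> \<theta> w v h t \<omega>)) = (\<Sum>t\<le>h. (norm (e t \<omega>))\<^sup>2)"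
    by (simp add: power2_norm_eq_inner)
  then show ?thesis
    unfolding cost_def Let_def prediction_error[symmetric]
    unfolding z_estimate_measurement hcat_vjoin power2_norm_eq_inner
    by (simp del: state.simps)
qed

lemma integrable_norm_square: "square_integrable M U \<Longrightarrow> integrable M (\<lambda>\<omega>. (norm (U \<omega>))\<^sup>2)"
  by (simp add: square_integrable_def)

lemma integrable_cost: "integrable M (cost A C L m0 \<xi> \<theta> w v h \<pi>)"
proof -
  have "integrable M (\<lambda>\<omega>. cost A C L m0 \<xi> \<theta> w v h \<pi> \<omega>)"
    unfolding cost_eq
    by (intro Bochner_Integration.integrable_add Bochner_Integration.integrable_sum
        integrable_norm_square square_integrable_diff square_integrable_matrix_mult
        square_integrable_e square_integrable_z)
  then show ?thesis .
qed

text \<open>Completing the square: the mixed term vanishes by \<open>prediction_error_orthogonal\<close>.\<close>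
lemma J_eq:
  "J h \<pi> = J h (kalman_policy A C W V X0 h)
    + (hcat (\<pi> - kalman_policy A C W V X0 h) ** H h) \<bullet> hcat (\<pi> - kalman_policy A C W V X0 h)"
proof -
  define past where "past \<omega> = (\<Sum>t\<le>h. (norm (e t \<omega>))\<^sup>2) + (norm (e (Suc h) \<omega>))\<^sup>2" for \<omega>
  have past: "integrable M past"
    unfolding past_def
    by (intro Bochner_Integration.integrable_add Bochner_Integration.integrable_sum
        integrable_norm_square square_integrable_e)
  have "J h \<pi> = (\<integral>\<omega>. past \<omega> \<partial>M) + (D ** H h) \<bullet> D"
    if D: "D = hcat (\<pi> - kalman_policy A C W V X0 h)" for \<pi> D
  proof -
    have Dz: "square_integrable M (\<lambda>\<omega>. D *v z h \<omega>)"
      by (intro square_integrable_matrix_mult square_integrable_z)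
    have "cost A C L m0 \<xi> \<theta> w v h \<pi> \<omega>
        = past \<omega> - 2 * (e (Suc h) \<omega> \<bullet> (D *v z h \<omega>)) + (D *v z h \<omega>) \<bullet> (D *v z h \<omega>)" for \<omega>
      unfolding cost_eq past_def D[symmetric] power2_norm_eq_inner
      by (simp add: inner_diff_left inner_diff_right inner_commute)
    then have "J h \<pi> = (\<integral>\<omega>. past \<omega> - 2 * (e (Suc h) \<omega> \<bullet> (D *v z h \<omega>))
        + (D *v z h \<omega>) \<bullet> (D *v z h \<omega>) \<partial>M)"
      by (simp add: J_def objective_def)
    also have "\<dots> = (\<integral>\<omega>. past \<omega> \<partial>M) - 2 * (cross_moment M (e (Suc h)) (z h) \<bullet> D)
        + cross_moment M (\<lambda>\<omega>. D *v z h \<omega>) (z h) \<bullet> D"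
      using past inner_cross_moment(2)[OF square_integrable_e square_integrable_z]
        inner_cross_moment(2)[OF Dz square_integrable_z]
      by (simp add: inner_cross_moment(1)[OF square_integrable_e square_integrable_z]
          inner_cross_moment(1)[OF Dz square_integrable_z])
    also have "\<dots> = (\<integral>\<omega>. past \<omega> \<partial>M) + (D ** H h) \<bullet> D"
      by (simp add: prediction_error_orthogonal cross_moment_matrix_mult_left square_integrable_z H_def)
    finally show ?thesis .
  qed
  note expand = this[OF refl]
  have "hcat (kalman_policy A C W V X0 h - kalman_policy A C W V X0 h) = 0"
    by (simp add: hcat_zero)
  then show ?thesis
    unfolding expand[of \<pi>] expand[of "kalman_policy A C W V X0 h"] by simp
qed

lemma J_quadratic_function:
  assumes "posdef (H h)"
  shows "quadratic_function (J h) (\<lambda>\<Delta>. hsplit (hcat \<Delta> ** H h)) (kalman_policy A C W V X0 h)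
    (J h (kalman_policy A C W V X0 h))"
proof
  have sym: "transpose (H h) = H h" using assms by (simp add: posdef_def)
  show "hsplit (hcat (\<Delta> + \<Delta>') ** H h) = hsplit (hcat \<Delta> ** H h) + hsplit (hcat \<Delta>' ** H h)" for \<Delta> \<Delta>'
    by (simp add: hcat_add matrix_add_rdistrib linear_add[OF linear_hsplit])
  show "hsplit (hcat (r *\<^sub>R \<Delta>) ** H h) = r *\<^sub>R hsplit (hcat \<Delta> ** H h)" for r \<Delta>
    by (simp add: hcat_scaleR scaleR_matrix_mult linear_scale[OF linear_hsplit])
  show "\<Delta> \<bullet> hsplit (hcat \<Delta>' ** H h) = hsplit (hcat \<Delta> ** H h) \<bullet> \<Delta>'" for \<Delta> \<Delta>'
    unfolding inner_commute[of \<Delta>] inner_hsplit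
    using inner_matrix_mult_symmetric_commute[OF sym, of "hcat \<Delta>" "hcat \<Delta>'"]
    by (simp add: inner_commute)
  show "J h \<pi> = J h (kalman_policy A C W V X0 h) +
      hsplit (hcat (\<pi> - kalman_policy A C W V X0 h) ** H h) \<bullet> (\<pi> - kalman_policy A C W V X0 h)" for \<pi>
    unfolding inner_hsplit by (rule J_eq)
qed

end

theorem theorem4p1:
  fixes M :: "'s measure"
    and A W X0 \<Theta> :: "real^'n^'n" and C :: "real^'n^'m" and V :: "real^'m^'m"
    and m0 :: "real^'n"
    and \<xi> \<theta> :: "'s \<Rightarrow> real^'n" and w :: "nat \<Rightarrow> 's \<Rightarrow> real^'n" and v :: "nat \<Rightarrow> 's \<Rightarrow> real^'m"
    and N h :: nat
  assumes "prob_space M"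
    and "posdef W" and "posdef V" and "posdef X0" and "posdef \<Theta>"
    and "m0 \<noteq> 0"
    and "observable_pair C A"
    and "gaussian_vec M \<xi> m0 X0" and "gaussian_vec M \<theta> 0 \<Theta>"
    and "\<And>t. gaussian_vec M (w t) 0 W" and "\<And>t. gaussian_vec M (v t) 0 V"
    and "sources_independent M \<xi> \<theta> w v"
    and "0 < N" and "h < N"
  defines "L \<equiv> kalman_L A C W V X0"
  defines "x \<equiv> state A \<xi> \<theta> w h h"
    and "y \<equiv> measurement A C \<xi> \<theta> w v h h"
    and "xhat \<equiv> estimate A C L m0 \<xi> \<theta> w v h h"
    and "J \<equiv> objective M A C L m0 \<xi> \<theta> w v h"
  defines "\<mu>x \<equiv> (\<integral>\<omega>. x \<omega> \<partial>M)"
    and "\<mu>xhat \<equiv> (\<integral>\<omega>. xhat \<omega> \<partial>M)"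
    and "H \<equiv> (\<integral>\<omega>. moment_integrand (xhat \<omega>) (y \<omega>) \<partial>M)"
    and "X \<equiv> state_cov A W X0 h"
    and "S \<equiv> kalman_cov A C W V X0 h"
  shows "integrable M x \<and> integrable M xhat \<and>
      integrable M (\<lambda>\<omega>. moment_integrand (xhat \<omega>) (y \<omega>)) \<and>
      (\<forall>\<pi>. integrable M (cost A C L m0 \<xi> \<theta> w v h \<pi>)) \<and>
      twice_cont_differentiable J \<and>
      (\<forall>\<pi> \<Delta> \<Delta>'. hessian_form J \<pi> \<Delta> \<Delta>' = 2 * ((hcat \<Delta> ** H) \<bullet> hcat \<Delta>')) \<and>
      H = mean_block C V \<Theta> \<mu>xhat \<mu>x + past_cov_block C X (X - S) \<and>
      posdef (mean_block C V \<Theta> \<mu>xhat \<mu>x) \<and> posdef H \<and>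
      strongly_convex_with (lambda_min H) J \<and>
      strongly_convex_with (lambda_min H) (\<lambda>\<pi>. J \<pi> / 2) \<and>
      smooth_with (lambda_max H) (\<lambda>\<pi>. J \<pi> / 2) \<and>
      (\<forall>\<pi>. is_arg_min J (\<lambda>_. True) \<pi> \<longleftrightarrow> \<pi> = kalman_policy A C W V X0 h)"
proof -
  interpret prob_space M by fact
  note pd = \<open>posdef V\<close> \<open>posdef \<Theta>\<close>
  note gauss = assms(8-11)
  note si = gauss[THEN gaussian_vec_square_integrable]
  note mean = gauss[THEN gaussian_vec_mean]
  note ind = \<open>sources_independent M \<xi> \<theta> w v\<close>[unfolded sources_independent_def]
  \<comment> \<open>Distinct sources are independent in pairs, and all of them except \<open>\<xi>\<close> are centred.\<close>
  note pair = indep_sets_imp_indep_set[OF ind UNIV_I UNIV_I]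
  have outer_0: "outer a 0 = 0" "outer 0 b = 0" for a :: "real^'p" and b :: "real^'q"
    by (simp_all add: outer_def vec_eq_iff)
  interpret FP: filtering_problem M A W X0 \<Theta> C V m0 \<xi> \<theta> w v
  proof
    show "cross_moment M (\<lambda>\<omega>. \<xi> \<omega> - m0) (\<lambda>\<omega>. \<xi> \<omega> - m0) = X0"
      by (rule gaussian_vec_covariance[OF gauss(1)])
    show "cross_moment M \<theta> \<theta> = \<Theta>" "cross_moment M (w t) (w t) = W" "cross_moment M (v t) (v t) = V"
      for t
      using gauss(2-4)[THEN gaussian_vec_covariance] by simp_all
    show "cross_moment M \<xi> \<theta> = 0"
      using cross_moment_indep[OF _ si(1,2)] pair[of Initial Perturbation] by (simp add: mean outer_0)
    show "cross_moment M \<xi> (w t) = 0" for t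
      using cross_moment_indep[OF _ si(1,3)] pair[of Initial "Process t"] by (simp add: mean outer_0)
    show "cross_moment M \<xi> (v t) = 0" for t
      using cross_moment_indep[OF _ si(1,4)] pair[of Initial "Measurement t"] by (simp add: mean outer_0)
    show "cross_moment M (w t) \<theta> = 0" for t
      using cross_moment_indep[OF _ si(3,2)] pair[of "Process t" Perturbation] by (simp add: mean outer_0)
    show "cross_moment M (v t) \<theta> = 0" for t
      using cross_moment_indep[OF _ si(4,2)] pair[of "Measurement t" Perturbation] by (simp add: mean outer_0)
    show "cross_moment M (w s) (v t) = 0" for s t
      using cross_moment_indep[OF _ si(3,4)] pair[of "Process s" "Measurement t"] by (simp add: mean outer_0)
    show "cross_moment M (w s) (w t) = 0" if "s \<noteq> t" for s t
      using cross_moment_indep[OF _ si(3,3)] pair[of "Process s" "Process t"] that by (simp add: mean outer_0)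
    show "cross_moment M (v s) (v t) = 0" if "s \<noteq> t" for s t
      using cross_moment_indep[OF _ si(4,4)] pair[of "Measurement s" "Measurement t"] that
      by (simp add: mean outer_0)
  qed (use pd si mean in auto)
  define \<pi>_opt where "\<pi>_opt = kalman_policy A C W V X0 h"
  have x: "x = (\<lambda>\<omega>. FP.x h \<omega> + \<theta> \<omega>)"
    by (simp add: x_def FP.state_perturbed fun_eq_iff)
  have xhat: "xhat = (\<lambda>\<omega>. FP.xh h \<omega> + \<theta> \<omega>)"
    by (simp add: xhat_def L_def FP.estimate_perturbed fun_eq_iff)
  have \<mu>x: "\<mu>x = FP.\<mu> h" and \<mu>xhat: "\<mu>xhat = FP.\<mu> h"
    by (simp_all add: \<mu>x_def \<mu>xhat_def x xhat FP.integrable_process FP.means FP.mean_xh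
        flip: FP.\<mu>_def)
  have integrand: "moment_integrand (xhat \<omega>) (y \<omega>) = outer (FP.z h \<omega>) (FP.z h \<omega>)" for \<omega>
    by (simp add: moment_integrand_vjoin FP.z_estimate_measurement xhat_def y_def L_def)
  have H: "H = FP.H h"
    by (simp add: H_def integrand FP.H_def cross_moment_def)
  have J: "J = FP.J h" by (simp add: J_def L_def FP.J_def fun_eq_iff)
  have posH: "posdef H" unfolding H by (rule FP.posdef_H[OF \<open>posdef \<Theta>\<close>])
  interpret Q: quadratic_function J "\<lambda>\<Delta>. hsplit (hcat \<Delta> ** H)" \<pi>_opt "J \<pi>_opt"
    unfolding \<pi>_opt_def J H by (rule FP.J_quadratic_function[OF posH[unfolded H]])
  interpret Q2: quadratic_function "\<lambda>\<pi>. J \<pi> / 2" "\<lambda>\<Delta>. (1 / 2) *\<^sub>R hsplit (hcat \<Delta> ** H)" \<pi>_opt "J \<pi>_opt / 2"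
    using Q.scaled[of "1 / 2"] by simp
  have coercive: "lambda_min H * (norm \<Delta>)\<^sup>2 \<le> hsplit (hcat \<Delta> ** H) \<bullet> \<Delta>" for \<Delta>
    using inner_matrix_mult_ge_lambda_min[OF posH, of "hcat \<Delta>"]
    by (simp add: inner_hsplit norm_hcat)
  note min_pos = posdef_lambda_min_pos[OF posH] and max_nonneg = posdef_lambda_max_nonneg[OF posH]
  \<comment> \<open>Without the factor \<open>1 / 2\<close>, the objective is even strongly convex with the constant
    \<open>2 * lambda_min H\<close>.\<close>
  have half_coercive: "lambda_min H / 2 * (norm \<Delta>)\<^sup>2 \<le> hsplit (hcat \<Delta> ** H) \<bullet> \<Delta>" for \<Delta>
  proof -
    have "lambda_min H / 2 * (norm \<Delta>)\<^sup>2 \<le> lambda_min H * (norm \<Delta>)\<^sup>2"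
      using min_pos by (intro mult_right_mono) auto
    then show ?thesis using coercive[of \<Delta>] by linarith
  qed
  show ?thesis
  proof (intro conjI allI)
    show "integrable M x" "integrable M xhat"
      by (simp_all add: x xhat FP.integrable_process)
    show "integrable M (\<lambda>\<omega>. moment_integrand (xhat \<omega>) (y \<omega>))"
      unfolding integrand by (intro integrable_outer FP.square_integrable_z)
    show "integrable M (cost A C L m0 \<xi> \<theta> w v h \<pi>)" for \<pi>
      unfolding L_def by (rule FP.integrable_cost)
    show "twice_cont_differentiable J" by (rule Q.twice_cont_differentiable)
    show "hessian_form J \<pi> \<Delta> \<Delta>' = 2 * ((hcat \<Delta> ** H) \<bullet> hcat \<Delta>')" for \<pi> \<Delta> \<Delta>'
      by (simp add: Q.hessian_form inner_hsplit)
    show "H = mean_block C V \<Theta> \<mu>xhat \<mu>x + past_cov_block C X (X - S)"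
      unfolding H \<mu>x \<mu>xhat X_def S_def by (rule FP.H_eq)
    show "posdef (mean_block C V \<Theta> \<mu>xhat \<mu>x)" by (rule posdef_mean_block[OF pd])
    show "posdef H" by (rule posH)
    show "strongly_convex_with (lambda_min H) J"
      by (rule Q.strongly_convex_with[OF min_pos half_coercive])
    show "strongly_convex_with (lambda_min H) (\<lambda>\<pi>. J \<pi> / 2)"
      using coercive by (intro Q2.strongly_convex_with min_pos) simp
    show "smooth_with (lambda_max H) (\<lambda>\<pi>. J \<pi> / 2)"
    proof (rule Q2.smooth_with[OF _ max_nonneg])
      show "2 * norm ((1 / 2) *\<^sub>R hsplit (hcat \<Delta> ** H)) \<le> lambda_max H * norm \<Delta>" for \<Delta>
        using norm_matrix_mult_le_lambda_max[OF posH, of "hcat \<Delta>"]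
        by (simp add: norm_hsplit norm_hcat)
    qed
    have "0 < hsplit (hcat \<Delta> ** H) \<bullet> \<Delta>" if "\<Delta> \<noteq> 0" for \<Delta>
      using coercive[of \<Delta>] min_pos that
      by (intro less_le_trans[OF _ coercive[of \<Delta>]]) simp
    then show "is_arg_min J (\<lambda>_. True) \<pi> \<longleftrightarrow> \<pi> = kalman_policy A C W V X0 h" for \<pi>
      unfolding \<pi>_opt_def[symmetric] by (rule Q.is_arg_min_iff)
  qed
qed

end
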